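(* Let $A_1,\dots,A_n$ be events in a probability space $(\Omega,\mathcal F,\mathbf P)$, let $r,d$ be integers with $1\le r\le n$ and $0\le d\le r$, and let $P_r$, $p_r$, $J_d$ and $\mathbf s(j)=(s_1(j),s_2(j),s_3(j))^T$ ($j\in J_d$) be as defined in the context. (i) If $r-d\ge 2$, then $$P_r\ge\sum_{j\in J_d}\boldsymbol\alpha^T\mathbf s(j)\quad\text{and}\quad p_n\ge\sum_{j\in J_d}\boldsymbol\delta^T\mathbf s(j),$$ where $$\boldsymbol\alpha=\frac1{\Delta_2}\begin{pmatrix}0\\ -C_{r-1}^{d+2}\\ C_{r-1}^{d+1}\end{pmatrix},\qquad \Delta_2=C_n^{d+2}C_{r-1}^{d+1}-C_n^{d+1}C_{r-1}^{d+2},$$ and $\boldsymbol\delta=\boldsymbol\alpha$ with $r=n$. (ii) If $r-d\ge 1$ and $n-r\ge 1$, then $$P_r\ge\sum_{j\in J_d}\boldsymbol\beta^T\mathbf s(j)\quad\text{and}\quad p_r\ge\sum_{j\in J_d}\boldsymbol\theta^T\mathbf s(j),$$ where $$\boldsymbol\theta=\frac1{C_r^d}\begin{pmatrix}-(r-d+1)(r-d-1)\\ (d+1)(2(r-d)-1)\\ -(d+1)(d+2)\end{pmatrix}$$ and $\boldsymbol\beta=(\beta_1,\beta_2,\beta_3)^T$ with $$\beta_1=\frac{m(r-d-1)(r-d-m-1)}{C_{m+d-1}^d\Delta_3}-\frac{(m-1)(r-d-1)(r-d-m)}{C_{m+d}^d\Delta_3},$$ $$\beta_2=(d+1)\left(-\frac{(r-d-m-1)(r-d+m-2)}{C_{m+d-1}^d\Delta_3}+\frac{(r-d-m)(r-d+m-3)}{C_{m+d}^d\Delta_3}\right),$$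 $$\beta_3=(d+1)(d+2)\left(\frac{r-d-m-1}{C_{m+d-1}^d\Delta_3}-\frac{r-d-m}{C_{m+d}^d\Delta_3}\right),$$ $\Delta_3=(r-d-m-1)(r-d-m)$, and $m$ is an arbitrary natural number such that $r-d+1\le m\le n-d$. The optimal value of $m$ is given by $$m-1\le (d+1)\frac{(d+2)s_3(j)-(r-d-2)s_2(j)}{(d+1)s_2(j)-(r-d-1)s_1(j)}\le m$$ provided $(d+1)s_2(j)-(r-d-1)s_1(j)>0$, and it is $r-d+1$ or $n-d$ otherwise. (iii) If $n-r\ge 2$ and $r=d$, then $$P_d\ge\sum_{j\in J_d}\boldsymbol\gamma^T\mathbf s(j)\quad\text{and}\quad p_d\ge\sum_{j\in J_d}\boldsymbol\varphi^T\mathbf s(j),$$ where $$\boldsymbol\varphi=\begin{pmatrix}1\\ -(d+1)\\ \frac{(d+1)(d+2)}{n-d}\end{pmatrix}$$ and $\boldsymbol\gamma=(\gamma_1,\gamma_2,\gamma_3)^T$ with $$\gamma_1=\frac{m(n-d)(n-d-m)}{C_{m+d-1}^d\Delta_4}-\frac{(m-1)(n-d)(n-d-m+1)}{C_{m+d}^d\Delta_4}+\frac{m(m-1)}{C_n^d\Delta_4},$$ $$\gamma_2=(d+1)\left(-\frac{(n-d-m)(n-d+m-1)}{C_{m+d-1}^d\Delta_4}+\frac{(n-d-m+1)(n-d+m-2)}{C_{m+d}^d\Delta_4}-\frac{2(m-1)}{C_n^d\Delta_4}\right),$$ $$\gamma_3=(d+1)(d+2)\left(\frac{n-d-m}{C_{m+d-1}^d\Delta_4}-\frac{n-d-m+1}{C_{m+d}^d\Delta_4}+\frac1{C_n^d\Delta_4}\right),$$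 $\Delta_4=(n-d-m)(n-d-m+1)$, and $m$ is an arbitrary natural number such that $1\le m\le n-d-1$. The optimal value of $m$ is given by $$m-1\le (d+1)\frac{(n-d-1)s_2(j)-(d+2)s_3(j)}{(n-d)s_1(j)-(d+1)s_2(j)}\le m$$ provided $(n-d)s_1(j)-(d+1)s_2(j)>0$, and it is $1$ or $n-d-1$ otherwise. (iv) If $r-d\ge 2$ and $n-r\ge 1$, then $$P_r\ge\sum_{j\in J_d}\max\left\{\boldsymbol\alpha^T\mathbf s(j),\ \boldsymbol\beta^T\mathbf s(j),\ \boldsymbol\gamma^T\mathbf s(j)\right\},$$ where $\boldsymbol\alpha$, $\boldsymbol\beta$, $\boldsymbol\gamma$ are the vectors given by the formulas in (i), (ii), (iii), respectively. (v) Let $\mathcal A\subset\mathcal F$ be a $\sigma$-field. The inequalities in (i)--(iv) bounding the probabilities hold almost surely if the probabilities $P_r$ and $p_r$ are replaced by $P_r^{\mathcal A}$ and $p_r^{\mathcal A}$ (likewise $p_n,P_d,p_d$ by $p_n^{\mathcal A},P_d^{\mathcal A},p_d^{\mathcal A}$) and $s_1(j),s_2(j),s_3(j)$ by $s_1^{\mathcal A}(j),s_2^{\mathcal A}(j),s_3^{\mathcal A}(j)$, correspondingly. In this case, the optimal $m$ are random variables.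
   Context: $C_u^v=\binom{u}{v}$ is the binomial coefficient, with $C_u^v=0$ for $v>u\ge 0$ and $C_u^0=1$. For events $A_1,\dots,A_n$, $B_i$ is the event that exactly $i$ of them occur ($i=0,\dots,n$) and $U_r=\bigcup_{i=r}^n B_i$ is the event that at least $r$ of them occur. Put $p_i=\mathbf P(B_i)$, $P_r=\mathbf P(U_r)=\sum_{i=r}^n p_i$. For a $\sigma$-field $\mathcal A\subset\mathcal F$, $p_i^{\mathcal A}=\mathbf P(B_i\mid\mathcal A)$ and $P_r^{\mathcal A}=\mathbf P(U_r\mid\mathcal A)$. For $1\le d\le n$, $J_d$ is the set of $j=(j_1,\dots,j_d)\in\mathbb N^d$ with $1\le j_1<\dots<j_d\le n$; $J_0=\{0\}$. For $j\in J_d$ write $A_{j_1}\cdots A_{j_d}$ for the intersection (equal to $\Omega$ if $d=0$), and $p_{i,j}=\mathbf P(B_i\cap A_{j_1}\cdots A_{j_d})$. For $j\in J_d$ let $\mathbf z(j)=(z_1(j),\dots,z_{n-d+1}(j))^T$ with $z_i(j)=p_{i+d-1,j}/C_{i+d-1}^d$, let $\mathbf F$ be the $3\times(n-d+1)$ matrix with entries $C_{i+d-1}^{k+d-1}$ ($k=1,2,3$; $i=1,\dots,n-d+1$), and let $\mathbf s(j)=\mathbf F\mathbf z(j)$, that is, $$s_k(j)=\sum_{i=1}^{n-d+1} C_{i+d-1}^{k+d-1}\,\frac{p_{i+d-1,j}}{C_{i+d-1}^d},\qquad k=1,2,3.$$ Equivalently, $$s_k(j)=\frac{d!}{(k+d-1)!}\sum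 \mathbf P\bigl(A_{u_1}\cdots A_{u_{k-1}}A_{j_1}\cdots A_{j_d}\bigr),$$ where the sum is over all ordered $(k-1)$-tuples of pairwise distinct indices $u_1,\dots,u_{k-1}\in\{1,\dots,n\}\setminus\{j_1,\dots,j_d\}$ (for $d=0$ over $\{1,\dots,n\}$); in particular $s_1(j)=\mathbf P(A_{j_1}\cdots A_{j_d})$. The random variables $s_k^{\mathcal A}(j)$ are defined by the right-hand side of the last formula with $\mathbf P(\cdot)$ replaced by $\mathbf P(\cdot\mid\mathcal A)$.
   Formalization: (iv) is false as printed (for d=0, γᵀs=1); proved instead, also conditionally: P_r ≥ Σ max{αᵀs, βᵀs} and P_d ≥ Σ max{αᵀs, βᵀs, γᵀs}. In (ii), if the denominator is positive but no admissible m satisfies the inequalities, the optimal m is r-d+1 or n-d. *)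

theory Defs
  imports "HOL-Probability.Probability"
begin

text \<open>Events are \<open>A 1, \<dots>, A n\<close>; the values of \<open>A\<close> outside \<open>{1..n}\<close> are irrelevant.\<close>

definition exactly_occur :: "'a measure \<Rightarrow> (nat \<Rightarrow> 'a set) \<Rightarrow> nat \<Rightarrow> nat \<Rightarrow> 'a set" where
  "exactly_occur M A n i = {\<omega> \<in> space M. card {k \<in> {1..n}. \<omega> \<in> A k} = i}"

definition at_least_occur :: "'a measure \<Rightarrow> (nat \<Rightarrow> 'a set) \<Rightarrow> nat \<Rightarrow> nat \<Rightarrow> 'a set" where
  "at_least_occur M A n r = (\<Union>i\<in>{r..n}. exactly_occur M A n i)"

text \<open>A tuple \<open>j\<^sub>1 < \<dots> < j\<^sub>d\<close> is a strictly increasing list; for \<open>d = 0\<close> the only one is the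
  empty list, and the corresponding intersection is the whole space.\<close>

definition index_tuples :: "nat \<Rightarrow> nat \<Rightarrow> nat list set" where
  "index_tuples n d = {j. length j = d \<and> sorted_wrt (<) j \<and> set j \<subseteq> {1..n}}"

definition joint :: "'a measure \<Rightarrow> (nat \<Rightarrow> 'a set) \<Rightarrow> nat list \<Rightarrow> 'a set" where
  "joint M A j = {\<omega> \<in> space M. \<forall>k\<in>set j. \<omega> \<in> A k}"

definition z_coord :: "'a measure \<Rightarrow> (nat \<Rightarrow> 'a set) \<Rightarrow> nat \<Rightarrow> nat \<Rightarrow> nat list \<Rightarrow> nat \<Rightarrow> real" where
  "z_coord M A n d j i =
     measure M (exactly_occur M A n (i + d - 1) \<inter> joint M A j) / real ((i + d - 1) choose d)"

definition s_coord :: "'a measure \<Rightarrow> (nat \<Rightarrow> 'a set) \<Rightarrow> nat \<Rightarrow> nat \<Rightarrow> nat list \<Rightarrow> nat \<Rightarrow> real" where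
  "s_coord M A n d j k =
     (\<Sum>i = 1..n - d + 1. real ((i + d - 1) choose (k + d - 1)) * z_coord M A n d j i)"

definition s_vec :: "'a measure \<Rightarrow> (nat \<Rightarrow> 'a set) \<Rightarrow> nat \<Rightarrow> nat \<Rightarrow> nat list \<Rightarrow> real^3" where
  "s_vec M A n d j = vector [s_coord M A n d j 1, s_coord M A n d j 2, s_coord M A n d j 3]"

definition cond_pr :: "'a measure \<Rightarrow> 'a measure \<Rightarrow> 'a set \<Rightarrow> 'a \<Rightarrow> real" where
  "cond_pr M G E = real_cond_exp M G (indicator E)"

definition s_cond_coord ::
  "'a measure \<Rightarrow> 'a measure \<Rightarrow> (nat \<Rightarrow> 'a set) \<Rightarrow> nat \<Rightarrow> nat \<Rightarrow> nat list \<Rightarrow> nat \<Rightarrow> 'a \<Rightarrow> real" where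
  "s_cond_coord M G A n d j k \<omega> = fact d / fact (k + d - 1) *
     (\<Sum>u \<in> {u. length u = k - 1 \<and> distinct u \<and> set u \<subseteq> {1..n} - set j}.
        cond_pr M G (joint M A (u @ j)) \<omega>)"

definition s_cond_vec ::
  "'a measure \<Rightarrow> 'a measure \<Rightarrow> (nat \<Rightarrow> 'a set) \<Rightarrow> nat \<Rightarrow> nat \<Rightarrow> nat list \<Rightarrow> 'a \<Rightarrow> real^3" where
  "s_cond_vec M G A n d j \<omega> =
     vector [s_cond_coord M G A n d j 1 \<omega>, s_cond_coord M G A n d j 2 \<omega>, s_cond_coord M G A n d j 3 \<omega>]"

definition alpha_vec :: "nat \<Rightarrow> nat \<Rightarrow> nat \<Rightarrow> real^3" where
  "alpha_vec n r d =
     (let D2 = real (n choose (d + 2)) * real ((r - 1) choose (d + 1))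
             - real (n choose (d + 1)) * real ((r - 1) choose (d + 2))
      in (1 / D2) *\<^sub>R vector [0, - real ((r - 1) choose (d + 2)), real ((r - 1) choose (d + 1))])"

definition delta_vec :: "nat \<Rightarrow> nat \<Rightarrow> real^3" where
  "delta_vec n d = alpha_vec n n d"

definition beta_vec :: "nat \<Rightarrow> nat \<Rightarrow> nat \<Rightarrow> real^3" where
  "beta_vec r' d' m' =
     (let r = real r'; d = real d'; m = real m';
          D3 = (r - d - m - 1) * (r - d - m);
          b = real ((m' + d' - 1) choose d') * D3;
          c = real ((m' + d') choose d') * D3
      in vector
        [m * (r - d - 1) * (r - d - m - 1) / b - (m - 1) * (r - d - 1) * (r - d - m) / c,
         (d + 1) * (- ((r - d - m - 1) * (r - d + m - 2) / b) + (r - d - m) * (r - d + m - 3) / c),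
         (d + 1) * (d + 2) * ((r - d - m - 1) / b - (r - d - m) / c)])"

definition theta_vec :: "nat \<Rightarrow> nat \<Rightarrow> real^3" where
  "theta_vec r' d' =
     (let r = real r'; d = real d'
      in (1 / real (r' choose d')) *\<^sub>R vector
        [- ((r - d + 1) * (r - d - 1)),
         (d + 1) * (2 * (r - d) - 1),
         - ((d + 1) * (d + 2))])"

definition gamma_vec :: "nat \<Rightarrow> nat \<Rightarrow> nat \<Rightarrow> real^3" where
  "gamma_vec n' d' m' =
     (let n = real n'; d = real d'; m = real m';
          D4 = (n - d - m) * (n - d - m + 1);
          b = real ((m' + d' - 1) choose d') * D4;
          c = real ((m' + d') choose d') * D4;
          e = real (n' choose d') * D4
      in vector
        [m * (n - d) * (n - d - m) / b - (m - 1) * (n - d) * (n - d - m + 1) / c + m * (m - 1) / e,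
         (d + 1) * (- ((n - d - m) * (n - d + m - 1) / b)
                    + (n - d - m + 1) * (n - d + m - 2) / c - 2 * (m - 1) / e),
         (d + 1) * (d + 2) * ((n - d - m) / b - (n - d - m + 1) / c + 1 / e)])"

definition phi_vec :: "nat \<Rightarrow> nat \<Rightarrow> real^3" where
  "phi_vec n' d' =
     (let n = real n'; d = real d'
      in vector [1, - (d + 1), (d + 1) * (d + 2) / (n - d)])"

text \<open>The optimal parameter \<open>m\<close> for a given vector \<open>s\<close> maximizes the lower bound over the
  admissible range.\<close>

definition beta_optimal :: "nat \<Rightarrow> nat \<Rightarrow> nat \<Rightarrow> real^3 \<Rightarrow> nat \<Rightarrow> bool" where
  "beta_optimal n r d s m = is_arg_max (\<lambda>m. beta_vec r d m \<bullet> s) (\<lambda>m. m \<in> {r - d + 1..n - d}) m"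

definition gamma_optimal :: "nat \<Rightarrow> nat \<Rightarrow> real^3 \<Rightarrow> nat \<Rightarrow> bool" where
  "gamma_optimal n d s m = is_arg_max (\<lambda>m. gamma_vec n d m \<bullet> s) (\<lambda>m. m \<in> {1..n - d - 1}) m"

definition beta_denom :: "nat \<Rightarrow> nat \<Rightarrow> real^3 \<Rightarrow> real" where
  "beta_denom r d s = (real d + 1) * s$2 - (real r - real d - 1) * s$1"

definition beta_criterion :: "nat \<Rightarrow> nat \<Rightarrow> real^3 \<Rightarrow> nat \<Rightarrow> bool" where
  "beta_criterion r d s m =
     (let q = (real d + 1) * (((real d + 2) * s$3 - (real r - real d - 2) * s$2) / beta_denom r d s)
      in real m - 1 \<le> q \<and> q \<le> real m)"

definition gamma_denom :: "nat \<Rightarrow> nat \<Rightarrow> real^3 \<Rightarrow> real" where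
  "gamma_denom n d s = (real n - real d) * s$1 - (real d + 1) * s$2"

definition gamma_criterion :: "nat \<Rightarrow> nat \<Rightarrow> real^3 \<Rightarrow> nat \<Rightarrow> bool" where
  "gamma_criterion n d s m =
     (let q = (real d + 1) * (((real n - real d - 1) * s$2 - (real d + 2) * s$3) / gamma_denom n d s)
      in real m - 1 \<le> q \<and> q \<le> real m)"

end

theory Submission
  imports Defs
begin

text \<open>Given the tuple \<open>j\<close>, let \<open>q j t\<close> be the (conditional) probability that \<open>A\<^bsub>j\<^sub>1\<^esub> \<dots> A\<^bsub>j\<^sub>d\<^esub>\<close> occurs
  together with exactly \<open>t\<close> further events. Then \<open>s(j) = (\<Sum>t. q j t * e(t))\<close> with
  \<open>e(t) = (1, t / (d + 1), t (t - 1) / ((d + 1) (d + 2)))\<close>, and since \<open>t + d\<close> occurring events contain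
  \<open>(t + d) choose d\<close> tuples, the target probabilities are sums of \<open>q j t * w(t)\<close> over \<open>j\<close> and the
  relevant \<open>t\<close>, where \<open>w(t) = 1 / ((t + d) choose d)\<close>. Every coefficient vector \<open>v\<close> thus represents
  the quadratic polynomial \<open>v \<bullet> e(t)\<close>, and each bound reduces to a pointwise inequality between this
  polynomial and \<open>w\<close> or a truncation of \<open>w\<close>.

  For \<open>\<beta>\<close> and \<open>\<gamma>\<close> the polynomials interpolate, and consecutive parameters satisfy
  \<open>v (m + 1) \<bullet> s - v m \<bullet> s = c m * (E(s) - m * D(s))\<close> with \<open>c m \<ge> 0\<close>, where \<open>D\<close> and \<open>E / D\<close> are the
  denominator and the quotient in the criterion for the optimal \<open>m\<close>. If \<open>D(s) > 0\<close>, then \<open>v m \<bullet> s\<close>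
  is unimodal in \<open>m\<close>, which yields the optimality criterion (\<open>c m > 0\<close> except for \<open>\<gamma>\<close> with \<open>d = 0\<close>,
  where \<open>w\<close> is constant); with \<open>s = e(t)\<close> it also yields the pointwise inequality, because the
  optimal polynomial touches \<open>w\<close> at \<open>t\<close>.\<close>

section \<open>Unimodal sequences\<close>

lemma monotone_on_steps:
  fixes h :: "nat \<Rightarrow> real"
  assumes "k \<le> l" and "\<And>i. k \<le> i \<Longrightarrow> i < l \<Longrightarrow> h i \<le> h (Suc i)"
  shows "h k \<le> h l"
  using assms
proof (induction l rule: dec_induct)
  case (step l)
  then have "h k \<le> h l" "h l \<le> h (Suc l)" by auto
  then show ?case by simp
qed auto

lemma antimonotone_on_steps:
  fixes h :: "nat \<Rightarrow> real"
  assumes "k \<le> l" and "\<And>i. k \<le> i \<Longrightarrow> i < l \<Longrightarrow> h (Suc i) \<le> h i"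
  shows "h l \<le> h k"
  using monotone_on_steps[of k l "\<lambda>i. - h i"] assms by simp

text \<open>The increments \<open>c i * (E - real i * D)\<close> change sign at most once, from
  nonnegative to nonpositive, so \<open>h\<close> climbs up to \<open>m\<close> and descends after
  it. The criterion is written without division, which admits \<open>D = 0\<close>, and is demanded
  only on sides where \<open>m\<close> has a neighbour in the interval.\<close>

lemma unimodal_le:
  fixes h c :: "nat \<Rightarrow> real"
  assumes step: "\<And>i. a \<le> i \<Longrightarrow> i < b \<Longrightarrow> h (Suc i) - h i = c i * (E - real i * D)"
    and c: "\<And>i. a \<le> i \<Longrightarrow> i < b \<Longrightarrow> 0 \<le> c i"
    and D: "0 \<le> D"
    and m: "m \<in> {a..b}"
    and lower: "a < m \<Longrightarrow> (real m - 1) * D \<le> E"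
    and upper: "m < b \<Longrightarrow> E \<le> real m * D"
    and k: "k \<in> {a..b}"
  shows "h k \<le> h m"
proof (cases "k \<le> m")
  case True
  show ?thesis
  proof (rule monotone_on_steps[OF True])
    fix i assume i: "k \<le> i" "i < m"
    have "real i * D \<le> (real m - 1) * D"
      by (rule mult_right_mono) (use i D in auto)
    also have "\<dots> \<le> E" using lower i k by auto
    finally have "0 \<le> c i * (E - real i * D)" using c[of i] i k m by simp
    then show "h i \<le> h (Suc i)" using step[of i] i k m by simp
  qed
next
  case False
  then have "m \<le> k" by simp
  then show ?thesis
  proof (rule antimonotone_on_steps)
    fix i assume i: "m \<le> i" "i < k"
    have "E \<le> real m * D" using upper i k by auto
    also have "\<dots> \<le> real i * D"
      by (rule mult_right_mono) (use i D in auto)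
    finally have "c i * (E - real i * D) \<le> 0"
      using c[of i] i k m by (simp add: mult_nonneg_nonpos)
    then show "h (Suc i) \<le> h i" using step[of i] i k m by simp
  qed
qed

lemma is_arg_max_atLeastAtMost_iff:
  fixes h :: "nat \<Rightarrow> real"
  shows "is_arg_max h (\<lambda>m. m \<in> {a..b}) m \<longleftrightarrow> m \<in> {a..b} \<and> (\<forall>k\<in>{a..b}. h k \<le> h m)"
  by (auto simp: is_arg_max_def not_less)

text \<open>Strict positivity of \<open>c\<close> makes an increment vanish only if
  \<open>E = real i * D\<close>. Hence an \<open>m\<close> violating the criterion has a strictly
  better neighbour in the direction of \<open>m0\<close>, and this neighbour is admissible because
  \<open>m0\<close> is.\<close>

lemma unimodal_arg_max_iff:
  fixes h c :: "nat \<Rightarrow> real"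
  assumes step: "\<And>i. a \<le> i \<Longrightarrow> i < b \<Longrightarrow> h (Suc i) - h i = c i * (E - real i * D)"
    and c: "\<And>i. a \<le> i \<Longrightarrow> i < b \<Longrightarrow> 0 < c i"
    and D: "0 < D"
    and m0: "m0 \<in> {a..b}" "real m0 - 1 \<le> E / D" "E / D \<le> real m0"
    and m: "m \<in> {a..b}"
  shows "is_arg_max h (\<lambda>m. m \<in> {a..b}) m \<longleftrightarrow> real m - 1 \<le> E / D \<and> E / D \<le> real m"
proof
  assume opt: "is_arg_max h (\<lambda>m. m \<in> {a..b}) m"
  show "real m - 1 \<le> E / D \<and> E / D \<le> real m"
  proof (intro conjI leI notI)
    assume less: "E / D < real m - 1"
    then have "m0 < m" using m0 by linarith
    then obtain i where i: "m = Suc i" "a \<le> i" "i < b"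
      using m m0 by (cases m) auto
    have "E - real i * D < 0" using less D i by (simp add: field_simps)
    then have "c i * (E - real i * D) < 0" using c[of i] i by (simp add: mult_pos_neg)
    then have "h (Suc i) < h i" using step[of i] i by simp
    then show False using opt i by (auto simp: is_arg_max_def)
  next
    assume less: "real m < E / D"
    then have "m < m0" using m0 by linarith
    then have i: "a \<le> m" "m < b" using m m0 by auto
    have "0 < E - real m * D" using less D by (simp add: field_simps)
    then have "h m < h (Suc m)" using step[of m] c[of m] i by (smt (verit) mult_pos_pos)
    then show False using opt i by (auto simp: is_arg_max_def)
  qed
next
  assume "real m - 1 \<le> E / D \<and> E / D \<le> real m"
  then have crit: "(real m - 1) * D \<le> E" "E \<le> real m * D" using D by (simp_all add: field_simps)
  have "h k \<le> h m" if "k \<in> {a..b}" for k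
    using step less_imp_le[OF c] less_imp_le[OF D] m crit that by (rule unimodal_le)
  then show "is_arg_max h (\<lambda>m. m \<in> {a..b}) m" using m unfolding is_arg_max_atLeastAtMost_iff by simp
qed

lemma ex_nat_ceiling_between:
  fixes q :: real
  assumes "a \<le> b" "1 \<le> a" "real a - 1 \<le> q" "q \<le> real b"
  shows "\<exists>m\<in>{a..b}. real m - 1 \<le> q \<and> q \<le> real m"
proof (cases "q \<le> real a")
  case True
  then show ?thesis using assms by auto
next
  case False
  then have "real (nat \<lceil>q\<rceil>) = of_int \<lceil>q\<rceil>" by simp
  then have "real (nat \<lceil>q\<rceil>) - 1 < q" "q \<le> real (nat \<lceil>q\<rceil>)" by linarith+
  then show ?thesis using assms False by (intro bexI[of _ "nat \<lceil>q\<rceil>"]) (simp, simp, linarith)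
qed

text \<open>Two reasons lead to an endpoint. If \<open>D \<le> 0\<close>, then
  \<open>E - real i * D\<close> grows with \<open>i\<close>, so \<open>h\<close> first falls and
  then rises. If \<open>D > 0\<close> and no admissible \<open>m\<close> meets the criterion, then
  \<open>E / D\<close> lies below \<open>a - 1\<close> or above \<open>b\<close>, and
  \<open>h\<close> is monotone on the whole interval.\<close>

lemma endpoint_arg_max:
  fixes h c :: "nat \<Rightarrow> real"
  assumes step: "\<And>i. a \<le> i \<Longrightarrow> i < b \<Longrightarrow> h (Suc i) - h i = c i * (E - real i * D)"
    and c: "\<And>i. a \<le> i \<Longrightarrow> i < b \<Longrightarrow> 0 \<le> c i"
    and ab: "1 \<le> a" "a \<le> b"
    and out: "D \<le> 0 \<or> \<not> (\<exists>m\<in>{a..b}. real m - 1 \<le> E / D \<and> E / D \<le> real m)"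
  shows "is_arg_max h (\<lambda>m. m \<in> {a..b}) a \<or> is_arg_max h (\<lambda>m. m \<in> {a..b}) b"
proof (cases "D \<le> 0")
  case True
  have "h k \<le> max (h a) (h b)" if k: "k \<in> {a..b}" for k
  proof (cases "0 \<le> E - real k * D")
    case nonneg: True
    have "h k \<le> h b"
    proof (rule monotone_on_steps)
      fix i assume i: "k \<le> i" "i < b"
      have "real i * D \<le> real k * D" using i True by (intro mult_right_mono_neg) auto
      then have "0 \<le> c i * (E - real i * D)" using nonneg c[of i] i k by simp
      then show "h i \<le> h (Suc i)" using step[of i] i k by simp
    qed (use k in auto)
    then show ?thesis by simp
  next
    case neg: False
    have "h k \<le> h a"
    proof (rule antimonotone_on_steps)
      fix i assume i: "a \<le> i" "i < k"
      have "real k * D \<le> real i * D" using i True by (intro mult_right_mono_neg) auto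
      then have "c i * (E - real i * D) \<le> 0"
        using neg c[of i] i k by (simp add: mult_nonneg_nonpos)
      then show "h (Suc i) \<le> h i" using step[of i] i k by simp
    qed (use k in auto)
    then show ?thesis by simp
  qed
  then have "(\<forall>k\<in>{a..b}. h k \<le> h b) \<or> (\<forall>k\<in>{a..b}. h k \<le> h a)"
    by (cases "h a \<le> h b") (simp_all add: max_def)
  then show ?thesis using ab unfolding is_arg_max_atLeastAtMost_iff by auto
next
  case False
  then have D: "0 < D" by simp
  then have "E / D < real a - 1 \<or> real b < E / D"
    using out ex_nat_ceiling_between[of a b "E / D"] ab by (meson not_le)
  then show ?thesis
  proof
    assume "E / D < real a - 1"
    then have "E \<le> (real a - 1) * D" using D by (simp add: field_simps)
    also have "\<dots> \<le> real a * D" using D by (intro mult_right_mono) auto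
    finally have "h k \<le> h a" if "k \<in> {a..b}" for k
      by (intro unimodal_le[of a b h c E D a k] step c) (use D ab that in auto)
    then show ?thesis using ab unfolding is_arg_max_atLeastAtMost_iff by auto
  next
    assume "real b < E / D"
    have "(real b - 1) * D \<le> real b * D" using D by (intro mult_right_mono) auto
    also have "\<dots> \<le> E" using D \<open>real b < E / D\<close> by (simp add: field_simps)
    finally have "h k \<le> h b" if "k \<in> {a..b}" for k
      by (intro unimodal_le[of a b h c E D b k] step c) (use D ab that in auto)
    then show ?thesis using ab unfolding is_arg_max_atLeastAtMost_iff by auto
  qed
qed

section \<open>Reciprocal binomial coefficients\<close>

definition weight :: "nat \<Rightarrow> nat \<Rightarrow> real" where
  "weight d t = 1 / real ((t + d) choose d)"

lemma weight_pos: "0 < weight d t"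
  by (simp add: weight_def)

lemma weight_Suc: "weight d (Suc t) = weight d t * (real t + 1) / (real t + real d + 1)"
  by (simp add: weight_def binomial_fact field_simps)

lemma weight_0: "weight d 0 = 1"
  by (simp add: weight_def)

lemma weight_antimono: "s \<le> t \<Longrightarrow> weight d t \<le> weight d s"
proof (rule antimonotone_on_steps)
  fix i
  show "weight d (Suc i) \<le> weight d i"
    using weight_pos[of d i] by (simp add: weight_Suc field_simps)
qed

text \<open>As a function of \<open>t\<close>, \<open>weight d t\<close> is \<open>d!\<close> over
  \<open>(t + 1) ... (t + d)\<close>, a completely monotone sequence. With \<open>x = k + d\<close>
  its third difference is minus
  \<open>weight d k * d (d + 1) (d + 2) / ((x + 1) (x + 2) (x + 3))\<close>; this vanishes for
  \<open>d = 0\<close>, where the weights are constant.\<close>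

lemma third_difference_weight:
  assumes "1 \<le> d"
  shows "weight d (k + 3) - 3 * weight d (k + 2) + 3 * weight d (k + 1) - weight d k < 0"
proof -
  define x where "x = real k + real d"
  have x: "0 < x + 1" "0 < x + 2" "0 < x + 3" by (simp_all add: x_def)
  have w1: "weight d (k + 1) = weight d k * (x + 1 - real d) / (x + 1)"
    by (simp add: weight_Suc x_def algebra_simps)
  have w2: "weight d (k + 2) = weight d (k + 1) * (x + 2 - real d) / (x + 2)"
    using weight_Suc[of d "k + 1"] by (simp add: x_def algebra_simps)
  have w3: "weight d (k + 3) = weight d (k + 2) * (x + 3 - real d) / (x + 3)"
    using weight_Suc[of d "k + 2"] by (simp add: x_def algebra_simps numeral_3_eq_3)
  have "weight d (k + 3) - 3 * weight d (k + 2) + 3 * weight d (k + 1) - weight d k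
      = - (weight d k * (real d * (real d + 1) * (real d + 2)) / ((x + 1) * (x + 2) * (x + 3)))"
    unfolding w3 w2 w1 using x by (simp add: divide_simps) algebra
  moreover have "0 < weight d k * (real d * (real d + 1) * (real d + 2)) / ((x + 1) * (x + 2) * (x + 3))"
    using x weight_pos[of d k] assms by (intro divide_pos_pos mult_pos_pos) auto
  ultimately show ?thesis by linarith
qed

text \<open>Summing three times: the zeros at \<open>0\<close>, \<open>1\<close>, \<open>2\<close>
  start the inductions that carry positivity from third to second differences, then to first
  differences, then to values.\<close>

lemma pos_if_third_difference_pos:
  fixes f :: "nat \<Rightarrow> real"
  assumes "f 0 = 0" "f 1 = 0" "f 2 = 0"
    and step: "\<And>k. 0 < f (k + 3) - 3 * f (k + 2) + 3 * f (k + 1) - f k"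
  shows "0 < f (k + 3)"
proof -
  have second: "0 < f (k + 3) - 2 * f (k + 2) + f (k + 1)" for k
  proof (induction k)
    case 0
    then show ?case using step[of 0] assms by (simp add: eval_nat_numeral)
  next
    case (Suc k)
    then show ?case using step[of "Suc k"] by (simp add: eval_nat_numeral)
  qed
  have first: "0 < f (k + 3) - f (k + 2)" for k
  proof (induction k)
    case 0
    then show ?case using second[of 0] assms by (simp add: eval_nat_numeral)
  next
    case (Suc k)
    then show ?case using second[of "Suc k"] by (simp add: eval_nat_numeral)
  qed
  show ?thesis
  proof (induction k)
    case 0
    then show ?case using first[of 0] assms by (simp add: eval_nat_numeral)
  next
    case (Suc k)
    then show ?case using first[of "Suc k"] by (simp add: eval_nat_numeral)
  qed
qed

text \<open>Third divided difference of the weights at \<open>k, k + 1, k + 2, k + 1 + y\<close>, with negative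
  sign and cleared denominators: interpolating quadratics of a completely monotone function
  overshoot to the right of the nodes.\<close>

lemma weight_extrapolation:
  assumes "1 \<le> d" and "2 \<le> y"
  shows "2 * weight d (k + 1 + y) + 2 * weight d (k + 1) * ((real y)\<^sup>2 - 1)
    < weight d k * (real y * (real y - 1)) + weight d (k + 2) * (real y * (real y + 1))"
proof -
  \<comment> \<open>Twice the error of quadratic interpolation of the weights at \<open>k\<close>,
    \<open>k + 1\<close>, \<open>k + 2\<close>, evaluated at \<open>k + i\<close>; the claim is its
    positivity for \<open>i = y + 1\<close>.\<close>
  define f where "f i = weight d k * ((real i - 1) * (real i - 2)) + weight d (k + 2) * ((real i - 1) * real i)
      - 2 * weight d (k + 1) * ((real i - 1)\<^sup>2 - 1) - 2 * weight d (k + i)" for i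
  have f0: "f 0 = 0" "f 1 = 0" "f 2 = 0"
    by (simp_all add: f_def power2_eq_square eval_nat_numeral)
  have st: "0 < f (i + 3) - 3 * f (i + 2) + 3 * f (i + 1) - f i" for i
  proof -
    \<comment> \<open>Third differences annihilate quadratics, so only the weight term of
      \<open>f\<close> survives.\<close>
    have "f (i + 3) - 3 * f (i + 2) + 3 * f (i + 1) - f i
      = - 2 * (weight d (k + i + 3) - 3 * weight d (k + i + 2) + 3 * weight d (k + i + 1) - weight d (k + i))"
      unfolding f_def by (simp add: algebra_simps power2_eq_square)
    moreover have "weight d (k + i + 3) - 3 * weight d (k + i + 2) + 3 * weight d (k + i + 1) - weight d (k + i) < 0"
      by (rule third_difference_weight[OF assms(1)])
    ultimately show ?thesis by (metis mult_neg_neg neg_less_0_iff_less zero_less_numeral)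
  qed
  obtain i where y: "y = i + 2" using assms(2) by (metis add.commute le_Suc_ex)
  have "0 < f (i + 3)" using f0 st by (rule pos_if_third_difference_pos)
  then show ?thesis unfolding f_def y by (simp add: algebra_simps power2_eq_square eval_nat_numeral)
qed

section \<open>The coefficient vectors as polynomials\<close>

lemma inner_vector_3: "vector [a, b, c] \<bullet> (s :: real^3) = a * s$1 + b * s$2 + c * s$3"
  by (simp add: inner_vec_def sum_3)

definition moment_vec :: "nat \<Rightarrow> nat \<Rightarrow> real^3" where
  "moment_vec d t = vector [1, real t / (real d + 1),
     real t * (real t - 1) / ((real d + 1) * (real d + 2))]"

lemma moment_vec_nth:
  "moment_vec d t $ 1 = 1"
  "moment_vec d t $ 2 = real t / (real d + 1)"
  "moment_vec d t $ 3 = real t * (real t - 1) / ((real d + 1) * (real d + 2))"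
  by (simp_all add: moment_vec_def)

lemma moment_vec_scaled:
  "(real d + 1) * moment_vec d t $ 2 = real t"
  "(real d + 1) * ((real d + 2) * moment_vec d t $ 3) = real t * (real t - 1)"
proof -
  have "real d + 1 \<noteq> 0" "real d + 2 \<noteq> 0" by linarith+
  then show "(real d + 1) * moment_vec d t $ 2 = real t"
    "(real d + 1) * ((real d + 2) * moment_vec d t $ 3) = real t * (real t - 1)"
    by (simp_all add: moment_vec_nth divide_simps)
qed

text \<open>The numerator \<open>E\<close> is kept apart from the quotient, so that the increment
  identities hold whatever the sign of the denominator.\<close>

definition beta_numer :: "nat \<Rightarrow> nat \<Rightarrow> real^3 \<Rightarrow> real" where
  "beta_numer r d s = (real d + 1) * ((real d + 2) * s$3 - (real r - real d - 2) * s$2)"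

definition gamma_numer :: "nat \<Rightarrow> nat \<Rightarrow> real^3 \<Rightarrow> real" where
  "gamma_numer n d s = (real d + 1) * ((real n - real d - 1) * s$2 - (real d + 2) * s$3)"

lemma beta_criterion_iff:
  "beta_criterion r d s m \<longleftrightarrow>
     real m - 1 \<le> beta_numer r d s / beta_denom r d s \<and> beta_numer r d s / beta_denom r d s \<le> real m"
  by (simp add: beta_criterion_def beta_numer_def Let_def)

lemma gamma_criterion_iff:
  "gamma_criterion n d s m \<longleftrightarrow>
     real m - 1 \<le> gamma_numer n d s / gamma_denom n d s \<and> gamma_numer n d s / gamma_denom n d s \<le> real m"
  by (simp add: gamma_criterion_def gamma_numer_def Let_def)

text \<open>For a unit mass at \<open>t\<close> the numerator is \<open>t\<close> times the
  denominator, so the quotient in the criterion is \<open>t\<close> itself: the optimal parameters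
  are those having \<open>t\<close> among the nodes \<open>m - 1\<close> and
  \<open>m\<close>.\<close>

lemma beta_moment:
  "beta_denom r d (moment_vec d t) = real t - real r + real d + 1"
  "beta_numer r d (moment_vec d t) = real t * (real t - real r + real d + 1)"
proof -
  show "beta_denom r d (moment_vec d t) = real t - real r + real d + 1"
    unfolding beta_denom_def moment_vec_scaled by (simp add: moment_vec_nth)
  have "beta_numer r d (moment_vec d t) = (real d + 1) * ((real d + 2) * moment_vec d t $ 3)
      - (real r - real d - 2) * ((real d + 1) * moment_vec d t $ 2)"
    by (simp add: beta_numer_def algebra_simps)
  then show "beta_numer r d (moment_vec d t) = real t * (real t - real r + real d + 1)"
    unfolding moment_vec_scaled by (simp add: algebra_simps)
qed

lemma gamma_moment:
  "gamma_denom n d (moment_vec d t) = real n - real d - real t"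
  "gamma_numer n d (moment_vec d t) = real t * (real n - real d - real t)"
proof -
  show "gamma_denom n d (moment_vec d t) = real n - real d - real t"
    unfolding gamma_denom_def moment_vec_scaled by (simp add: moment_vec_nth)
  have "gamma_numer n d (moment_vec d t) = (real n - real d - 1) * ((real d + 1) * moment_vec d t $ 2)
      - (real d + 1) * ((real d + 2) * moment_vec d t $ 3)"
    by (simp add: gamma_numer_def algebra_simps)
  then show "gamma_numer n d (moment_vec d t) = real t * (real n - real d - real t)"
    unfolding moment_vec_scaled by (simp add: algebra_simps)
qed

text \<open>With \<open>g t = weight d t / (t - (r - d) + 1)\<close>, the polynomial \<open>t \<mapsto> beta_vec r d m \<bullet> moment_vec d t\<close> is
  \<open>t - (r - d) + 1\<close> times the linear interpolant of \<open>g\<close> at \<open>m - 1\<close> and \<open>m\<close>.\<close>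

lemma beta_vec_inner:
  assumes "r < m + d" and "1 \<le> m"
  shows "beta_vec r d m \<bullet> s =
      weight d m / (real m + real d - real r + 1) * (beta_numer r d s - (real m - 1) * beta_denom r d s)
    - weight d (m - 1) / (real m + real d - real r) * (beta_numer r d s - real m * beta_denom r d s)"
proof -
  \<comment> \<open>The factor \<open>D3\<close> in the definition becomes
    \<open>X * (X + 1)\<close>; eliminating \<open>r\<close> in favour of \<open>X\<close> exposes
    both factors as nonzero.\<close>
  define X where "X = real m + real d - real r"
  define p where "p = real ((m + d - 1) choose d)"
  define q where "q = real ((m + d) choose d)"
  have X: "0 < X" and r: "real r = real m + real d - X" using assms by (simp_all add: X_def)
  have nz: "X \<noteq> 0" "X + 1 \<noteq> 0" "p \<noteq> 0" "q \<noteq> 0"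
    using X assms by (simp_all add: p_def q_def)
  have w: "weight d (m - 1) = 1 / p" "weight d m = 1 / q"
    using assms by (simp_all add: weight_def p_def q_def)
  show ?thesis
    unfolding beta_vec_def Let_def inner_vector_3 w beta_numer_def beta_denom_def r p_def[symmetric] q_def[symmetric]
    using nz by (simp add: divide_simps add_eq_0_iff split: if_splits) algebra
qed

text \<open>Lagrange form: for \<open>s = moment_vec d t\<close> the three summands carry the
  weights at \<open>m\<close>, \<open>m - 1\<close> and \<open>n - d\<close>, and each vanishes at
  the two other nodes. So the polynomial of \<open>gamma_vec n d m\<close> interpolates the weights
  at these three points.\<close>

lemma gamma_vec_inner:
  assumes "m + d < n" and "1 \<le> m"
  shows "gamma_vec n d m \<bullet> s =
      weight d m / (real n - real d - real m) * (gamma_numer n d s - (real m - 1) * gamma_denom n d s)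
    - weight d (m - 1) / (real n - real d - real m + 1) * (gamma_numer n d s - real m * gamma_denom n d s)
    + weight d (n - d) / ((real n - real d - real m) * (real n - real d - real m + 1)) *
        (real m * (real m - 1) * s$1 - 2 * (real m - 1) * (real d + 1) * s$2 + (real d + 1) * (real d + 2) * s$3)"
proof -
  define Y where "Y = real n - real d - real m"
  define p where "p = real ((m + d - 1) choose d)"
  define q where "q = real ((m + d) choose d)"
  define e where "e = real (n choose d)"
  have Y: "0 < Y" and n: "real n = real m + real d + Y" using assms by (simp_all add: Y_def)
  have nz: "Y \<noteq> 0" "Y + 1 \<noteq> 0" "p \<noteq> 0" "q \<noteq> 0" "e \<noteq> 0"
    using Y assms by (simp_all add: p_def q_def e_def)
  have w: "weight d (m - 1) = 1 / p" "weight d m = 1 / q" "weight d (n - d) = 1 / e"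
    using assms by (simp_all add: weight_def p_def q_def e_def)
  show ?thesis
    unfolding gamma_vec_def Let_def inner_vector_3 w gamma_numer_def gamma_denom_def n p_def[symmetric] q_def[symmetric] e_def[symmetric]
    using nz by (simp add: divide_simps add_eq_0_iff split: if_splits) algebra
qed

section \<open>Increments in the parameter \<open>m\<close>\<close>

text \<open>The second difference, at \<open>m - 1\<close>, \<open>m\<close>, \<open>m + 1\<close>,
  of the function \<open>g\<close> whose linear interpolants define the \<open>beta_vec\<close>
  polynomials.\<close>

definition beta_gain :: "nat \<Rightarrow> nat \<Rightarrow> nat \<Rightarrow> real" where
  "beta_gain r d m = weight d (m + 1) / (real m + real d - real r + 2)
     - 2 * weight d m / (real m + real d - real r + 1) + weight d (m - 1) / (real m + real d - real r)"

text \<open>Minus twice the third divided difference of the weights at \<open>m - 1\<close>,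
  \<open>m\<close>, \<open>m + 1\<close>, \<open>n - d\<close>.\<close>

definition gamma_gain :: "nat \<Rightarrow> nat \<Rightarrow> nat \<Rightarrow> real" where
  "gamma_gain n d m = weight d (m + 1) / (real n - real d - real m - 1)
     - 2 * weight d m / (real n - real d - real m) + weight d (m - 1) / (real n - real d - real m + 1)
     - 2 * weight d (n - d) /
        ((real n - real d - real m - 1) * (real n - real d - real m) * (real n - real d - real m + 1))"

text \<open>Consecutive polynomials agree at the shared node \<open>m\<close> and both vanish at
  \<open>r - d - 1\<close>, so they differ by a multiple of
  \<open>(t - m) (t - (r - d) + 1)\<close>. This product is the value of
  \<open>beta_numer - m * beta_denom\<close> at \<open>moment_vec d t\<close>.\<close>

lemma beta_vec_step:
  assumes "r < m + d" and "1 \<le> m"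
  shows "beta_vec r d (Suc m) \<bullet> s - beta_vec r d m \<bullet> s
    = beta_gain r d m * (beta_numer r d s - real m * beta_denom r d s)"
proof -
  define u where "u = real m + real d - real r"
  have u: "real m + 1 + real d - real r + 1 = u + 2" "real m + 1 + real d - real r = u + 1"
    "real m + real d - real r + 2 = u + 2" "real m + real d - real r + 1 = u + 1"
    by (simp_all add: u_def)
  have next_inner: "beta_vec r d (Suc m) \<bullet> s =
      weight d (m + 1) / (u + 2) * (beta_numer r d s - real m * beta_denom r d s)
    - weight d m / (u + 1) * (beta_numer r d s - (real m + 1) * beta_denom r d s)"
    using beta_vec_inner[of r "Suc m" d s] assms by (simp add: u add.commute[of 1])
  show ?thesis
    unfolding next_inner beta_vec_inner[OF assms] beta_gain_def u u_def[symmetric]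
    by (simp add: ring_distribs diff_divide_distrib add_divide_distrib mult_ac)
qed

text \<open>Here the shared nodes are \<open>m\<close> and \<open>n - d\<close>, and the difference
  is a multiple of \<open>(t - m) (n - d - t)\<close>.\<close>

lemma gamma_vec_step:
  assumes "m + d + 1 < n" and "1 \<le> m"
  shows "gamma_vec n d (Suc m) \<bullet> s - gamma_vec n d m \<bullet> s
    = gamma_gain n d m * (gamma_numer n d s - real m * gamma_denom n d s)"
proof -
  define Y where "Y = real n - real d - real m"
  have "real (m + d + 1) < real n" using assms(1) by (simp only: of_nat_less_iff)
  then have nz: "Y \<noteq> 0" "Y + 1 \<noteq> 0" "Y - 1 \<noteq> 0" and n: "real n = real m + real d + Y"
    by (simp_all add: Y_def)
  show ?thesis
    using gamma_vec_inner[of "Suc m" d n s] gamma_vec_inner[of m d n s] assms nz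
    unfolding gamma_gain_def gamma_numer_def gamma_denom_def n
    by (simp add: divide_simps split: if_splits) algebra
qed

text \<open>Strict convexity of \<open>g\<close>: over a common denominator the second difference
  has a numerator that is a polynomial in \<open>a\<close>, \<open>b\<close>, \<open>x\<close> with
  nonnegative coefficients and the positive part \<open>2 (a + b) (a + b + 1)\<close>.\<close>

lemma beta_gain_pos:
  assumes "r < m + d" and "1 \<le> m" and "d \<le> r"
  shows "0 < beta_gain r d m"
proof -
  define x where "x = real m + real d - real r"
  \<comment> \<open>This scaling frees the weights at \<open>m - 1\<close> and \<open>m\<close> of
    denominators: they become \<open>v * (a + b)\<close> and \<open>v * a\<close>.\<close>
  define v where "v = weight d (m - 1) / (real m + real d)"
  define a where "a = real m"
  define b where "b = real d"
  have v: "0 < v" using weight_pos assms by (auto simp: v_def intro!: divide_pos_pos)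
  have pos: "0 < x" "0 < a" "0 \<le> b" using assms by (simp_all add: x_def a_def b_def)
  obtain k where k: "m = Suc k" using assms by (cases m) auto
  have w0: "weight d (m - 1) = v * (a + b)" using pos by (simp add: v_def a_def b_def)
  have w1: "weight d m = v * a" using weight_Suc[of d k] k by (simp add: v_def a_def algebra_simps)
  have w2: "weight d (m + 1) = v * a * (a + 1) / (a + b + 1)"
    using weight_Suc[of d m] w1 by (simp add: a_def b_def algebra_simps)
  have "beta_gain r d m = v * (a * (a + 1) / ((a + b + 1) * (x + 2)) - 2 * a / (x + 1) + (a + b) / x)"
    unfolding beta_gain_def w0 w1 w2 x_def[symmetric] by (simp add: algebra_simps)
  also have "a * (a + 1) / ((a + b + 1) * (x + 2)) - 2 * a / (x + 1) + (a + b) / x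
    = (a * (a + 1) * x * (x + 1) - 2 * a * (a + b + 1) * x * (x + 2) + (a + b) * (a + b + 1) * (x + 1) * (x + 2))
       / ((a + b + 1) * (x + 2) * (x + 1) * x)"
    using pos by (simp add: divide_simps) algebra
  also have "a * (a + 1) * x * (x + 1) - 2 * a * (a + b + 1) * x * (x + 2) + (a + b) * (a + b + 1) * (x + 1) * (x + 2)
    = b * (b + 1) * x\<^sup>2 + x * (2 * a * b + 3 * b\<^sup>2 + 3 * b) + 2 * (a + b) * (a + b + 1)"
    by algebra
  finally have eq: "beta_gain r d m = v * ((b * (b + 1) * x\<^sup>2 + x * (2 * a * b + 3 * b\<^sup>2 + 3 * b) + 2 * (a + b) * (a + b + 1))
       / ((a + b + 1) * (x + 2) * (x + 1) * x))" .
  have "0 < b * (b + 1) * x\<^sup>2 + x * (2 * a * b + 3 * b\<^sup>2 + 3 * b) + 2 * (a + b) * (a + b + 1)"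
    using pos by (intro add_nonneg_pos add_nonneg_nonneg mult_nonneg_nonneg) auto
  then show ?thesis unfolding eq using v pos by simp
qed

text \<open>Over the positive denominator \<open>(y - 1) y (y + 1)\<close>, the gain is exactly the
  gap in \<open>weight_extrapolation\<close> for \<open>k = m - 1\<close> and
  \<open>y = n - d - m\<close>.\<close>

lemma gamma_gain_pos:
  assumes "m + d + 1 < n" and "1 \<le> m" and "1 \<le> d"
  shows "0 < gamma_gain n d m"
proof -
  define y where "y = n - d - m"
  obtain k where k: "m = k + 1" using assms by (metis add.commute le_Suc_ex)
  have y: "2 \<le> y" using assms by (simp add: y_def)
  have nd: "n - d = k + 1 + y" using assms k by (simp add: y_def)
  have Y: "real n - real d - real m = real y" using assms by (simp add: y_def)
  have ext: "2 * weight d (n - d) + 2 * weight d (k + 1) * ((real y)\<^sup>2 - 1)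
    < weight d k * (real y * (real y - 1)) + weight d (k + 2) * (real y * (real y + 1))"
    unfolding nd by (rule weight_extrapolation[OF assms(3) y])
  have "p / (z - 1) - 2 * q / z + w / (z + 1) - 2 * e / ((z - 1) * z * (z + 1))
      = (w * (z * (z - 1)) + p * (z * (z + 1)) - 2 * q * (z\<^sup>2 - 1) - 2 * e) / ((z - 1) * z * (z + 1))"
    if "1 < z" for p q w e z :: real
    using that by (simp add: divide_simps) algebra
  from this[of "real y" "weight d (k + 2)" "weight d (k + 1)" "weight d k" "weight d (n - d)"]
  have "gamma_gain n d m = (weight d k * (real y * (real y - 1)) + weight d (k + 2) * (real y * (real y + 1))
      - 2 * weight d (k + 1) * ((real y)\<^sup>2 - 1) - 2 * weight d (n - d)) / ((real y - 1) * real y * (real y + 1))"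
    unfolding gamma_gain_def Y using y k by (simp add: numeral_2_eq_2)
  then show ?thesis using ext y by simp
qed

lemma gamma_gain_nonneg:
  assumes "m + d + 1 < n" and "1 \<le> m"
  shows "0 \<le> gamma_gain n d m"
proof (cases "d = 0")
  case True
  define Y where "Y = real n - real m"
  have "real (m + d + 1) < real n" using assms(1) by (simp only: of_nat_less_iff)
  then have "1 < Y" using True by (simp add: Y_def)
  have "gamma_gain n d m = 1 / (Y - 1) - 2 / Y + 1 / (Y + 1) - 2 / ((Y - 1) * Y * (Y + 1))"
    by (simp add: gamma_gain_def weight_def True Y_def)
  also have "\<dots> = 0" using \<open>1 < Y\<close> by (simp add: divide_simps) (simp add: algebra_simps)
  finally show ?thesis by simp
next
  case False
  then show ?thesis using gamma_gain_pos[OF assms] by simp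
qed

lemma choose_Suc_ratio: "d + i \<le> u \<Longrightarrow>
    real (u choose (d + Suc i)) = real (u choose (d + i)) * (real u - real d - real i) / (real d + real i + 1)"
proof -
  assume le: "d + i \<le> u"
  have "real (Suc (d + i) * (u choose Suc (d + i))) = real ((u - (d + i)) * (u choose (d + i)))"
    by (simp only: binomial_absorption binomial_absorb_comp)
  then show ?thesis using le by (simp add: field_simps)
qed

section \<open>Pointwise comparison of the polynomials with the weights\<close>

text \<open>The polynomial is \<open>weight d (n - d) * (x (x - R) / (N (N - R)))\<close>, with
  zeros \<open>0\<close> and \<open>R = r - 1 - d\<close>. It is nonpositive between the zeros;
  beyond \<open>R\<close> it stays below its value at \<open>N\<close>, which is the smallest
  weight.\<close>

lemma alpha_vec_moment_le:
  assumes "d + 2 \<le> r" and "r \<le> n" and "t \<le> n - d"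
  shows "alpha_vec n r d \<bullet> moment_vec d t \<le> (if r \<le> t + d then weight d t else 0)"
proof -
  define b where "b = real d"
  define N where "N = real n - b"
  define R where "R = real r - 1 - b"
  define c where "c = real ((r - 1) choose (d + 1))"
  define e where "e = real (n choose d)"
  define x where "x = real t"
  have pos: "0 \<le> b" "1 \<le> R" "R < N" "0 < c" "0 < e" "0 \<le> x" "x \<le> N"
    using assms by (auto simp: b_def N_def R_def c_def e_def x_def)
  have c2: "real ((r - 1) choose (d + 2)) = c * (R - 1) / (b + 2)"
    using choose_Suc_ratio[of d 1 "r - 1"] assms by (simp add: c_def R_def b_def add.commute)
  have n1: "real (n choose (d + 1)) = e * N / (b + 1)"
    using choose_Suc_ratio[of d 0 n] assms by (simp add: e_def N_def b_def add.commute)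
  have n2: "real (n choose (d + 2)) = e * N / (b + 1) * (N - 1) / (b + 2)"
    using choose_Suc_ratio[of d 1 n] assms n1 by (simp add: e_def N_def b_def add.commute)
  have w: "weight d (n - d) = 1 / e" using assms by (simp add: weight_def e_def)
  have D2: "real (n choose (d + 2)) * c - real (n choose (d + 1)) * (c * (R - 1) / (b + 2))
      = e * c * N * (N - R) / ((b + 1) * (b + 2))"
    unfolding n1 n2 using pos by (simp add: divide_simps) algebra
  have "alpha_vec n r d \<bullet> moment_vec d t
      = 1 / (e * c * N * (N - R) / ((b + 1) * (b + 2))) *
          (c * (x * (x - 1) / ((b + 1) * (b + 2))) - c * (R - 1) / (b + 2) * (x / (b + 1)))"
    unfolding alpha_vec_def Let_def c_def[symmetric] c2 D2
    by (simp add: inner_vector_3 moment_vec_nth b_def[symmetric] x_def[symmetric])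
  also have "\<dots> = weight d (n - d) * (x * (x - R) / (N * (N - R)))"
    unfolding w using pos by (simp add: divide_simps) algebra
  finally have eq: "alpha_vec n r d \<bullet> moment_vec d t = weight d (n - d) * (x * (x - R) / (N * (N - R)))" .
  show ?thesis
  proof (cases "r \<le> t + d")
    case True
    then have "R \<le> x" by (simp add: R_def x_def b_def)
    then have "x * (x - R) \<le> N * (N - R)" using pos by (intro mult_mono) auto
    then have "x * (x - R) / (N * (N - R)) \<le> 1" using pos by (simp add: divide_le_eq_1)
    then have "weight d (n - d) * (x * (x - R) / (N * (N - R))) \<le> weight d (n - d) * 1"
      using weight_pos[of d "n - d"] by (intro mult_left_mono) auto
    also have "\<dots> \<le> weight d t" using weight_antimono[OF assms(3)] by simp
    finally show ?thesis using True eq by simp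
  next
    case False
    then have "x \<le> R" by (simp add: R_def x_def b_def)
    then have "x * (x - R) / (N * (N - R)) \<le> 0"
      using pos by (intro divide_nonpos_nonneg mult_nonneg_nonpos mult_nonneg_nonneg) auto
    then show ?thesis
      unfolding eq using False weight_pos[of d "n - d"] by (simp only: if_False mult_nonneg_nonpos less_imp_le)
  qed
qed

text \<open>For \<open>r \<le> t + d\<close>, unimodality in the parameter bounds the value by that
  of a polynomial passing through the weight at \<open>t\<close>. For smaller \<open>t\<close>, the
  factor \<open>t - (r - d) + 1\<close> is nonpositive while the linear interpolant of
  \<open>g\<close> is nonnegative.\<close>

lemma beta_vec_moment_le:
  assumes "d \<le> r" and "r < m + d" and "1 \<le> m"
  shows "beta_vec r d m \<bullet> moment_vec d t \<le> (if r \<le> t + d then weight d t else 0)"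
proof (cases "r \<le> t + d")
  case True
  define D where "D = beta_denom r d (moment_vec d t)"
  have D: "D = real t - real r + real d + 1" "0 < D"
    using True by (simp_all add: D_def beta_moment)
  have numer: "beta_numer r d (moment_vec d t) = real t * D"
    by (simp add: beta_moment D)
  \<comment> \<open>The maximum matters only for \<open>t = r - d\<close>, which lies below the
    admissible range; then \<open>k = t + 1\<close> has \<open>t\<close> as its lower node.\<close>
  define k where "k = max t (r - d + 1)"
  have "beta_vec r d m \<bullet> moment_vec d t \<le> beta_vec r d k \<bullet> moment_vec d t"
  \<comment> \<open>The right end only has to cover both parameters, since the gain is positive for
    all larger ones.\<close>
  proof (rule unimodal_le[where D = D and E = "real t * D" and c = "beta_gain r d" and
        a = "r - d + 1" and b = "max k m"])
    fix i assume i: "r - d + 1 \<le> i"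
    show "beta_vec r d (Suc i) \<bullet> moment_vec d t - beta_vec r d i \<bullet> moment_vec d t
        = beta_gain r d i * (real t * D - real i * D)"
      using i beta_vec_step[of r i d "moment_vec d t"] by (simp add: D_def[symmetric] numer)
    have "r < i + d" "1 \<le> i" using i by auto
    then show "0 \<le> beta_gain r d i" using assms by (simp add: beta_gain_pos less_imp_le)
  next
    show "(real k - 1) * D \<le> real t * D"
      using D(2) True by (intro mult_right_mono) (auto simp: k_def max_def)
    show "real t * D \<le> real k * D" using D(2) by (intro mult_right_mono) (auto simp: k_def)
  qed (use D assms in \<open>auto simp: k_def\<close>)
  also have "beta_vec r d k \<bullet> moment_vec d t = weight d t"
  proof (cases "r < t + d")
    case less: True
    then have "k = t" using assms by (auto simp: k_def)
    moreover have "real t + real d - real r + 1 = D" by (simp add: D)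
    moreover have "real t * D - (real t - 1) * D = D" by (simp add: algebra_simps)
    ultimately show ?thesis
      using beta_vec_inner[of r k d "moment_vec d t"] less D(2)
      by (simp add: D_def[symmetric] numer k_def)
  next
    case False
    then have t: "r = t + d" using True by simp
    then have "k = t + 1" "D = 1" by (simp_all add: k_def D)
    then show ?thesis
      using beta_vec_inner[of r k d "moment_vec d t"] t by (simp add: beta_moment)
  qed
  finally show ?thesis using True by simp
next
  case False
  define u where "u = real m + real d - real r"
  define y where "y = real r - real d - real t"
  have y: "1 \<le> y" and u: "1 \<le> u" using False assms by (auto simp: y_def u_def)
  have mt: "real m = real t + y + u" by (simp add: u_def y_def)
  have wts: "weight d m \<le> weight d (m - 1)" by (rule weight_antimono) simp
  have "beta_vec r d m \<bullet> moment_vec d t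
    = weight d m / (u + 1) * (real t * (1 - y) - (real m - 1) * (1 - y))
      - weight d (m - 1) / u * (real t * (1 - y) - real m * (1 - y))"
    using beta_vec_inner[OF assms(2,3), of "moment_vec d t"]
    by (simp add: beta_moment u_def y_def algebra_simps)
  \<comment> \<open>The second factor is the interpolant of \<open>g\<close> extrapolated to the
    left of its nodes; it is nonnegative because both the weights and the coefficients decrease from
    \<open>m - 1\<close> to \<open>m\<close>.\<close>
  also have "\<dots> = (1 - y) * (weight d (m - 1) * ((y + u) / u) - weight d m * ((y + u - 1) / (u + 1)))"
    unfolding mt using u by (simp add: divide_simps) algebra
  also have "\<dots> \<le> 0"
  proof (rule mult_nonpos_nonneg)
    have "weight d m * ((y + u - 1) / (u + 1)) \<le> weight d (m - 1) * ((y + u) / u)"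
      using wts weight_pos[of d m] y u by (intro mult_mono frac_le) (auto intro: less_imp_le[OF weight_pos])
    then show "0 \<le> weight d (m - 1) * ((y + u) / u) - weight d m * ((y + u - 1) / (u + 1))" by simp
  qed (use y in simp)
  finally show ?thesis using False by simp
qed

text \<open>The polynomial is \<open>weight d (r - d)\<close> times
  \<open>1 - (t - (r - d))^2\<close>: a parabola with its peak at \<open>r - d\<close> and zeros at
  the two neighbouring integers, hence nonpositive at every other integer.\<close>

lemma theta_vec_moment_le:
  assumes "d \<le> r"
  shows "theta_vec r d \<bullet> moment_vec d t \<le> (if t + d = r then weight d t else 0)"
proof -
  define x where "x = real t - (real r - real d)"
  have "theta_vec r d \<bullet> moment_vec d t = weight d (r - d) *
      (- ((real r - real d + 1) * (real r - real d - 1))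
       + (2 * (real r - real d) - 1) * ((real d + 1) * moment_vec d t $ 2)
       - (real d + 1) * ((real d + 2) * moment_vec d t $ 3))"
    using assms by (simp add: theta_vec_def Let_def inner_vector_3 weight_def moment_vec_nth(1) algebra_simps)
  also have "\<dots> = weight d (r - d) * (1 - x\<^sup>2)"
    unfolding moment_vec_scaled x_def by (simp add: algebra_simps power2_eq_square)
  finally have eq: "theta_vec r d \<bullet> moment_vec d t = weight d (r - d) * (1 - x\<^sup>2)" .
  show ?thesis
  proof (cases "t + d = r")
    case True
    then show ?thesis using eq by (auto simp: x_def)
  next
    case False
    then have "1 \<le> \<bar>x\<bar>" using assms by (auto simp: x_def)
    then have "1 \<le> x\<^sup>2" by (metis abs_ge_zero power2_abs one_le_power)
    then show ?thesis using False eq weight_pos[of d "r - d"] by (simp add: mult_nonneg_nonpos)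
  qed
qed

text \<open>By unimodality it suffices to bound the best parameter, and its polynomial attains the
  weight at \<open>t\<close>.\<close>

lemma gamma_vec_moment_le:
  assumes "1 \<le> m" and "m + d < n" and "t \<le> n - d"
  shows "gamma_vec n d m \<bullet> moment_vec d t \<le> weight d t"
proof -
  define D where "D = gamma_denom n d (moment_vec d t)"
  have D: "D = real n - real d - real t" "0 \<le> D"
    using assms by (auto simp add: D_def gamma_moment)
  have numer: "gamma_numer n d (moment_vec d t) = real t * D"
    by (simp add: gamma_moment D)
  have inner: "gamma_vec n d k \<bullet> moment_vec d t =
      weight d k / (real n - real d - real k) * (real t * D - (real k - 1) * D)
    - weight d (k - 1) / (real n - real d - real k + 1) * (real t * D - real k * D)
    + weight d (n - d) / ((real n - real d - real k) * (real n - real d - real k + 1)) *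
        ((real t - real k) * (real t - real k + 1))" if "k + d < n" "1 \<le> k" for k
  proof -
    have "real k * (real k - 1) * moment_vec d t $ 1 - 2 * (real k - 1) * (real d + 1) * moment_vec d t $ 2
        + (real d + 1) * (real d + 2) * moment_vec d t $ 3
      = real k * (real k - 1) - 2 * (real k - 1) * ((real d + 1) * moment_vec d t $ 2)
        + (real d + 1) * ((real d + 2) * moment_vec d t $ 3)"
      by (simp add: moment_vec_nth(1) mult.assoc)
    also have "\<dots> = (real t - real k) * (real t - real k + 1)"
      unfolding moment_vec_scaled by (simp add: algebra_simps)
    finally show ?thesis
      using gamma_vec_inner[OF that, of "moment_vec d t"] by (simp only: D_def[symmetric] numer)
  qed
  \<comment> \<open>\<open>t\<close> is clipped to the admissible range: for \<open>t = 0\<close>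
    the lower node of \<open>k = 1\<close> is \<open>t\<close>, and \<open>t = n - d\<close> is a
    node for every parameter.\<close>
  define k where "k = max 1 (min t (n - d - 1))"
  have "gamma_vec n d m \<bullet> moment_vec d t \<le> gamma_vec n d k \<bullet> moment_vec d t"
  proof (rule unimodal_le[where D = D and E = "real t * D" and c = "gamma_gain n d" and
        a = 1 and b = "n - d - 1"])
    fix i assume i: "1 \<le> i" "i < n - d - 1"
    show "gamma_vec n d (Suc i) \<bullet> moment_vec d t - gamma_vec n d i \<bullet> moment_vec d t
        = gamma_gain n d i * (real t * D - real i * D)"
      using i gamma_vec_step[of i d n "moment_vec d t"] by (simp add: D_def[symmetric] numer)
    show "0 \<le> gamma_gain n d i" using i by (intro gamma_gain_nonneg) auto
  next
    assume "1 < k"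
    show "(real k - 1) * D \<le> real t * D"
      using D(2) by (intro mult_right_mono) (auto simp: k_def max_def min_def)
  next
    assume "k < n - d - 1"
    then show "real t * D \<le> real k * D" using D(2) by (intro mult_right_mono) (auto simp: k_def)
  qed (use D assms in \<open>auto simp: k_def\<close>)
  also have "gamma_vec n d k \<bullet> moment_vec d t = weight d t"
  proof -
    consider "t = 0" | "1 \<le> t" "t + d < n" | "t = n - d" using assms by linarith
    then show ?thesis
    proof cases
      case 1
      then have "k = 1" by (simp add: k_def)
      moreover have "real n - real d = D" "0 < D" using assms 1 by (simp_all add: D)
      ultimately show ?thesis using inner[of k] assms 1 by simp
    next
      case 2
      then have "k = t" by (auto simp: k_def)
      moreover have "real t * D - (real t - 1) * D = D" by (simp add: algebra_simps)
      moreover have "0 < D" using 2 by (simp add: D)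
      ultimately show ?thesis using inner[of t] 2 by (simp add: D(1)[symmetric])
    next
      case 3
      then have "D = 0" using assms by (simp add: D)
      moreover have "k + d < n" "1 \<le> k" using assms by (auto simp: k_def)
      moreover have "real n - real d = real t" using 3 assms by simp
      moreover have "k < t" using calculation 3 by simp
      ultimately show ?thesis using inner[of k] 3 by simp
    qed
  qed
  finally show ?thesis .
qed

text \<open>The polynomial is \<open>(1 - t) (1 - t / (n - d))\<close>, which is \<open>1\<close> at
  \<open>0\<close> and nonpositive between its zeros \<open>1\<close> and
  \<open>n - d\<close>.\<close>

lemma phi_vec_moment_le:
  assumes "t \<le> n - d" and "d < n"
  shows "phi_vec n d \<bullet> moment_vec d t \<le> (if t = 0 then weight d t else 0)"
proof -
  define N where "N = real n - real d"
  have N: "0 < N" "real t \<le> N" using assms by (auto simp: N_def)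
  have "phi_vec n d \<bullet> moment_vec d t
      = 1 - (real d + 1) * moment_vec d t $ 2 + (real d + 1) * ((real d + 2) * moment_vec d t $ 3) / N"
    by (simp add: phi_vec_def Let_def inner_vector_3 N_def moment_vec_nth(1) algebra_simps)
  also have "\<dots> = (1 - real t) * (1 - real t / N)"
    unfolding moment_vec_scaled using N by (simp add: field_simps)
  finally have eq: "phi_vec n d \<bullet> moment_vec d t = (1 - real t) * (1 - real t / N)" .
  show ?thesis
  proof (cases "t = 0")
    case True
    then show ?thesis using eq by (simp add: weight_0)
  next
    case False
    then show ?thesis using eq N by (simp add: mult_nonpos_nonneg)
  qed
qed

section \<open>Optimal parameters\<close>

text \<open>Solvability of the criterion is part of the case distinction: the denominator averages
  \<open>t - (r - d) + 1\<close>, which can take both signs, so the quotient may leave the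
  admissible range even if the denominator is positive. Then an endpoint is optimal.\<close>

lemma beta_optimality:
  assumes "d < r" and "r < n"
  shows "if beta_denom r d s > 0 \<and> (\<exists>m\<in>{r - d + 1..n - d}. beta_criterion r d s m)
    then \<forall>m\<in>{r - d + 1..n - d}. beta_optimal n r d s m \<longleftrightarrow> beta_criterion r d s m
    else beta_optimal n r d s (r - d + 1) \<or> beta_optimal n r d s (n - d)"
proof -
  have step: "beta_vec r d (Suc i) \<bullet> s - beta_vec r d i \<bullet> s
      = beta_gain r d i * (beta_numer r d s - real i * beta_denom r d s)"
    and gain: "0 < beta_gain r d i" if "r - d + 1 \<le> i" for i
    using that assms by (auto intro: beta_vec_step beta_gain_pos)
  show ?thesis
  proof (split if_split, intro conjI impI ballI)
    fix m
    assume crit: "beta_denom r d s > 0 \<and> (\<exists>m\<in>{r - d + 1..n - d}. beta_criterion r d s m)"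
      and m: "m \<in> {r - d + 1..n - d}"
    from crit obtain m0 where "m0 \<in> {r - d + 1..n - d}" "beta_criterion r d s m0" by blast
    then show "beta_optimal n r d s m \<longleftrightarrow> beta_criterion r d s m"
      unfolding beta_optimal_def beta_criterion_iff using crit m
      by (intro unimodal_arg_max_iff[where c = "beta_gain r d"] step gain) auto
  next
    assume "\<not> (beta_denom r d s > 0 \<and> (\<exists>m\<in>{r - d + 1..n - d}. beta_criterion r d s m))"
    then show "beta_optimal n r d s (r - d + 1) \<or> beta_optimal n r d s (n - d)"
      unfolding beta_optimal_def beta_criterion_iff
      by (intro endpoint_arg_max[
        where c = "beta_gain r d" and E = "beta_numer r d s" and D = "beta_denom r d s"] step less_imp_le[OF gain])
        (use assms in auto)
  qed
qed

text \<open>The hypotheses \<open>range\<close> place the quotient between \<open>0\<close> and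
  \<open>n - d - 1\<close>, so a positive denominator already yields an admissible solution of the
  criterion.\<close>

lemma gamma_optimality:
  assumes "1 \<le> d" and "d + 2 \<le> n"
    and range: "0 \<le> gamma_numer n d s" "gamma_numer n d s \<le> (real n - real d - 1) * gamma_denom n d s"
  shows "if gamma_denom n d s > 0
    then (\<exists>m\<in>{1..n - d - 1}. gamma_criterion n d s m) \<and>
      (\<forall>m\<in>{1..n - d - 1}. gamma_optimal n d s m \<longleftrightarrow> gamma_criterion n d s m)
    else gamma_optimal n d s 1 \<or> gamma_optimal n d s (n - d - 1)"
proof -
  have step: "gamma_vec n d (Suc i) \<bullet> s - gamma_vec n d i \<bullet> s
      = gamma_gain n d i * (gamma_numer n d s - real i * gamma_denom n d s)"
    and gain: "0 < gamma_gain n d i" if "1 \<le> i" "i < n - d - 1" for i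
    using that assms by (auto intro!: gamma_vec_step gamma_gain_pos)
  show ?thesis
  proof (split if_split, intro conjI impI)
    assume D: "gamma_denom n d s > 0"
    have "real (n - d - 1) = real n - real d - 1" using assms(2) by linarith
    then have "real 1 - 1 \<le> gamma_numer n d s / gamma_denom n d s"
      "gamma_numer n d s / gamma_denom n d s \<le> real (n - d - 1)"
      using D range by (simp_all add: divide_le_eq del: of_nat_diff)
    then show "\<exists>m\<in>{1..n - d - 1}. gamma_criterion n d s m"
      unfolding gamma_criterion_iff using assms(2) by (intro ex_nat_ceiling_between) auto
    then obtain m0 where "m0 \<in> {1..n - d - 1}" "gamma_criterion n d s m0" by blast
    then show "\<forall>m\<in>{1..n - d - 1}. gamma_optimal n d s m \<longleftrightarrow> gamma_criterion n d s m"
      unfolding gamma_optimal_def gamma_criterion_iff using D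
      by (intro ballI unimodal_arg_max_iff[where c = "gamma_gain n d"] step gain) auto
  next
    assume "\<not> gamma_denom n d s > 0"
    then show "gamma_optimal n d s 1 \<or> gamma_optimal n d s (n - d - 1)"
      unfolding gamma_optimal_def
      by (intro endpoint_arg_max[
        where c = "gamma_gain n d" and E = "gamma_numer n d s" and D = "gamma_denom n d s"] step less_imp_le[OF gain])
        (use assms in auto)
  qed
qed

section \<open>Bounds for arbitrary nonnegative masses\<close>

text \<open>Abstracts from the measure: the instances are the probabilities and, for almost every
  outcome, the conditional probabilities, so each bound is derived once for both.\<close>

locale weighted_moments =
  fixes n d :: nat and q :: "nat list \<Rightarrow> nat \<Rightarrow> real" and s :: "nat list \<Rightarrow> real^3"
    and at_least exactly :: "nat \<Rightarrow> real"
  assumes q_nonneg: "\<And>j t. j \<in> index_tuples n d \<Longrightarrow> t \<le> n - d \<Longrightarrow> 0 \<le> q j t"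
    and s_eq: "\<And>j. j \<in> index_tuples n d \<Longrightarrow> s j = (\<Sum>t\<le>n - d. q j t *\<^sub>R moment_vec d t)"
    and at_least_eq: "\<And>r. d \<le> r \<Longrightarrow> r \<le> n \<Longrightarrow> at_least r =
      (\<Sum>j\<in>index_tuples n d. \<Sum>t\<le>n - d. (if r \<le> t + d then weight d t else 0) * q j t)"
    and exactly_eq: "\<And>r. d \<le> r \<Longrightarrow> r \<le> n \<Longrightarrow> exactly r =
      (\<Sum>j\<in>index_tuples n d. \<Sum>t\<le>n - d. (if t + d = r then weight d t else 0) * q j t)"
begin

text \<open>Linearity of the inner product reduces a bound on \<open>v \<bullet> s j\<close> to the
  pointwise one, integrated against nonnegative masses.\<close>

lemma inner_moments_le:
  assumes "j \<in> index_tuples n d" and "\<And>t. t \<le> n - d \<Longrightarrow> v \<bullet> moment_vec d t \<le> c t"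
  shows "v \<bullet> s j \<le> (\<Sum>t\<le>n - d. c t * q j t)"
proof -
  have "v \<bullet> s j = (\<Sum>t\<le>n - d. (v \<bullet> moment_vec d t) * q j t)"
    by (simp add: s_eq[OF assms(1)] inner_sum_right mult.commute)
  also have "\<dots> \<le> (\<Sum>t\<le>n - d. c t * q j t)"
    using assms by (intro sum_mono mult_right_mono q_nonneg) auto
  finally show ?thesis .
qed

lemma alpha_le:
  assumes "d + 2 \<le> r" "r \<le> n" "j \<in> index_tuples n d"
  shows "alpha_vec n r d \<bullet> s j \<le> (\<Sum>t\<le>n - d. (if r \<le> t + d then weight d t else 0) * q j t)"
  using assms by (intro inner_moments_le alpha_vec_moment_le)

lemma beta_le:
  assumes "d \<le> r" "m \<in> {r - d + 1..n - d}" "j \<in> index_tuples n d"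
  shows "beta_vec r d m \<bullet> s j \<le> (\<Sum>t\<le>n - d. (if r \<le> t + d then weight d t else 0) * q j t)"
  using assms by (intro inner_moments_le beta_vec_moment_le) auto

lemma gamma_le:
  assumes "m \<in> {1..n - d - 1}" "j \<in> index_tuples n d"
  shows "gamma_vec n d m \<bullet> s j \<le> (\<Sum>t\<le>n - d. weight d t * q j t)"
  using assms by (intro inner_moments_le gamma_vec_moment_le) auto

lemma tail_le:
  assumes "j \<in> index_tuples n d"
  shows "(\<Sum>t\<le>n - d. (if r \<le> t + d then weight d t else 0) * q j t) \<le> (\<Sum>t\<le>n - d. weight d t * q j t)"
  using assms by (intro sum_mono mult_right_mono q_nonneg) (auto intro: less_imp_le[OF weight_pos])

lemma at_least_d: "d \<le> n \<Longrightarrow> at_least d = (\<Sum>j\<in>index_tuples n d. \<Sum>t\<le>n - d. weight d t * q j t)"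
  by (simp add: at_least_eq)

lemma alpha_bound:
  assumes "r - d \<ge> 2" "r \<le> n"
  shows "at_least r \<ge> (\<Sum>j\<in>index_tuples n d. alpha_vec n r d \<bullet> s j)"
  using assms by (subst at_least_eq) (auto intro!: sum_mono alpha_le)

lemma delta_bound:
  assumes "n - d \<ge> 2"
  shows "exactly n \<ge> (\<Sum>j\<in>index_tuples n d. delta_vec n d \<bullet> s j)"
proof -
  \<comment> \<open>Within the range \<open>t \<le> n - d\<close>, the conditions
    \<open>n \<le> t + d\<close> and \<open>t + d = n\<close> coincide.\<close>
  have "exactly n = at_least n"
    using assms by (subst at_least_eq, simp, simp, subst exactly_eq) (auto intro!: sum.cong)
  then show ?thesis using alpha_bound[of n] assms by (simp add: delta_vec_def)
qed

text \<open>The comparison holds summand by summand, so the parameter may depend on the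
  tuple.\<close>

lemma beta_bound:
  assumes "d \<le> r" "r \<le> n" "m \<in> index_tuples n d \<rightarrow> {r - d + 1..n - d}"
  shows "at_least r \<ge> (\<Sum>j\<in>index_tuples n d. beta_vec r d (m j) \<bullet> s j)"
  unfolding at_least_eq[OF assms(1,2)] using assms by (intro sum_mono beta_le) auto

lemma theta_bound:
  assumes "d \<le> r" "r \<le> n"
  shows "exactly r \<ge> (\<Sum>j\<in>index_tuples n d. theta_vec r d \<bullet> s j)"
  unfolding exactly_eq[OF assms] using assms
  by (intro sum_mono inner_moments_le theta_vec_moment_le) auto

lemma gamma_bound:
  assumes "d \<le> n" "m \<in> index_tuples n d \<rightarrow> {1..n - d - 1}"
  shows "at_least d \<ge> (\<Sum>j\<in>index_tuples n d. gamma_vec n d (m j) \<bullet> s j)"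
  unfolding at_least_d[OF assms(1)] using assms by (intro sum_mono gamma_le) auto

lemma phi_bound:
  assumes "d < n"
  shows "exactly d \<ge> (\<Sum>j\<in>index_tuples n d. phi_vec n d \<bullet> s j)"
  using assms
  by (subst exactly_eq) (auto intro!: sum_mono inner_moments_le phi_vec_moment_le[THEN order_trans])

lemma max_bound:
  assumes "r - d \<ge> 2" "r \<le> n" "m \<in> index_tuples n d \<rightarrow> {r - d + 1..n - d}"
  shows "at_least r \<ge> (\<Sum>j\<in>index_tuples n d. max (alpha_vec n r d \<bullet> s j) (beta_vec r d (m j) \<bullet> s j))"
  using assms by (subst at_least_eq) (auto intro!: sum_mono max.boundedI alpha_le beta_le)

text \<open>The \<open>gamma_vec\<close> polynomial lies below the full weights only, so the common
  target is \<open>at_least d\<close>; the other two bounds reach it through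
  \<open>tail_le\<close>.\<close>

lemma Max_bound:
  assumes "r - d \<ge> 2" "r \<le> n" "m \<in> index_tuples n d \<rightarrow> {r - d + 1..n - d}"
    "m' \<in> index_tuples n d \<rightarrow> {1..n - d - 1}"
  shows "at_least d \<ge> (\<Sum>j\<in>index_tuples n d.
    Max {alpha_vec n r d \<bullet> s j, beta_vec r d (m j) \<bullet> s j, gamma_vec n d (m' j) \<bullet> s j})"
proof -
  have "Max {alpha_vec n r d \<bullet> s j, beta_vec r d (m j) \<bullet> s j, gamma_vec n d (m' j) \<bullet> s j}
      \<le> (\<Sum>t\<le>n - d. weight d t * q j t)" if j: "j \<in> index_tuples n d" for j
  proof -
    have "d + 2 \<le> r" "d \<le> r" "m j \<in> {r - d + 1..n - d}" "m' j \<in> {1..n - d - 1}"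
      using assms j by auto
    then show ?thesis
      using alpha_le[of r j] beta_le[of r "m j" j] gamma_le[of "m' j" j] tail_le[OF j, of r] assms(2) j
      by simp
  qed
  then show ?thesis using assms by (subst at_least_d) (auto intro: sum_mono)
qed

text \<open>The quotient of numerator by denominator is an average of \<open>t\<close> with
  nonnegative factors \<open>q j t * (n - d - t)\<close>. The factor at \<open>t = n - d\<close> is
  zero, so only values up to \<open>n - d - 1\<close> contribute.\<close>

lemma gamma_range:
  assumes "j \<in> index_tuples n d" "d < n"
  shows "0 \<le> gamma_numer n d (s j)"
    and "gamma_numer n d (s j) \<le> (real n - real d - 1) * gamma_denom n d (s j)"
proof -
  \<comment> \<open>Both quantities are linear in \<open>v\<close>; as inner products they
    distribute over the sum of moment vectors.\<close>
  have denom: "gamma_denom n d v = vector [real n - real d, - (real d + 1), 0] \<bullet> v" for v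
    by (simp add: gamma_denom_def inner_vector_3 algebra_simps)
  have numer: "gamma_numer n d v =
      vector [0, (real d + 1) * (real n - real d - 1), - ((real d + 1) * (real d + 2))] \<bullet> v" for v
    by (simp add: gamma_numer_def inner_vector_3 algebra_simps)
  have D: "gamma_denom n d (s j) = (\<Sum>t\<le>n - d. q j t * (real n - real d - real t))"
    unfolding denom s_eq[OF assms(1)] inner_sum_right inner_scaleR_right
    by (simp only: denom[symmetric] gamma_moment)
  have E: "gamma_numer n d (s j) = (\<Sum>t\<le>n - d. q j t * (real t * (real n - real d - real t)))"
    unfolding numer s_eq[OF assms(1)] inner_sum_right inner_scaleR_right
    by (simp only: numer[symmetric] gamma_moment)
  show "0 \<le> gamma_numer n d (s j)"
    unfolding E using assms by (intro sum_nonneg mult_nonneg_nonneg q_nonneg) auto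
  have "q j t * (real t * (real n - real d - real t))
      \<le> q j t * ((real n - real d - 1) * (real n - real d - real t))" if "t \<le> n - d" for t
  proof (cases "t = n - d")
    case True
    then show ?thesis using assms by simp
  next
    case False
    then have "real t + 1 \<le> real (n - d)" using that by linarith
    then show ?thesis using assms that by (intro mult_left_mono mult_right_mono q_nonneg) auto
  qed
  then show "gamma_numer n d (s j) \<le> (real n - real d - 1) * gamma_denom n d (s j)"
    unfolding D E sum_distrib_left by (intro sum_mono) (simp add: mult.left_commute)
qed

end

section \<open>Counting occurring events\<close>

lemma finite_index_tuples: "finite (index_tuples n d)"
  by (rule finite_subset[OF _ finite_lists_length_eq[of "{1..n}" d]]) (auto simp: index_tuples_def)

section \<open>Measurable choice of a maximizer\<close>

text \<open>The least maximizer is selected: being a maximizer is a finite conjunction of measurable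
  comparisons, and a least index over measurable predicates is measurable.\<close>

lemma ex_measurable_arg_max:
  fixes h :: "nat \<Rightarrow> 'a \<Rightarrow> real"
  assumes "a \<le> b" and [measurable]: "\<And>m. h m \<in> borel_measurable G"
  shows "\<exists>f \<in> measurable G (count_space UNIV). \<forall>\<omega>. is_arg_max (\<lambda>m. h m \<omega>) (\<lambda>m. m \<in> {a..b}) (f \<omega>)"
proof
  define P where "P m \<omega> \<longleftrightarrow> m \<in> {a..b} \<and> (\<forall>k\<in>{a..b}. h k \<omega> \<le> h m \<omega>)" for m \<omega>
  have [measurable]: "Measurable.pred G (P m)" for m
    unfolding P_def by measurable
  show "(\<lambda>\<omega>. LEAST m. P m \<omega>) \<in> measurable G (count_space UNIV)" by measurable
  show "\<forall>\<omega>. is_arg_max (\<lambda>m. h m \<omega>) (\<lambda>m. m \<in> {a..b}) (LEAST m. P m \<omega>)"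
  proof
    fix \<omega>
    have "Max ((\<lambda>m. h m \<omega>) ` {a..b}) \<in> (\<lambda>m. h m \<omega>) ` {a..b}"
      using assms(1) by (intro Max_in) auto
    then obtain m where "m \<in> {a..b}" "h m \<omega> = Max ((\<lambda>m. h m \<omega>) ` {a..b})" by force
    then have "P m \<omega>" by (simp add: P_def)
    then have "P (LEAST m. P m \<omega>) \<omega>" by (rule LeastI)
    then show "is_arg_max (\<lambda>m. h m \<omega>) (\<lambda>m. m \<in> {a..b}) (LEAST m. P m \<omega>)"
      unfolding is_arg_max_atLeastAtMost_iff by (simp add: P_def)
  qed
qed

section \<open>Tuples inside the set of occurring events\<close>

lemma card_sorted_lists_subset:
  assumes "finite B"
  shows "card {j. length j = d \<and> sorted_wrt (<) j \<and> set j \<subseteq> (B :: nat set)} = card B choose d"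
proof -
  have "bij_betw set {j. length j = d \<and> sorted_wrt (<) j \<and> set j \<subseteq> B} {C. C \<subseteq> B \<and> card C = d}"
  proof (rule bij_betw_byWitness[where f' = sorted_list_of_set])
    show "\<forall>j\<in>{j. length j = d \<and> sorted_wrt (<) j \<and> set j \<subseteq> B}. sorted_list_of_set (set j) = j"
      by (auto simp: strict_sorted_iff sorted_list_of_set.idem_if_sorted_distinct)
    show "\<forall>C\<in>{C. C \<subseteq> B \<and> card C = d}. set (sorted_list_of_set C) = C"
      using finite_subset[OF _ assms] by auto
    show "set ` {j. length j = d \<and> sorted_wrt (<) j \<and> set j \<subseteq> B} \<subseteq> {C. C \<subseteq> B \<and> card C = d}"
      by (auto simp: strict_sorted_iff distinct_card)
    show "sorted_list_of_set ` {C. C \<subseteq> B \<and> card C = d} \<subseteq> {j. length j = d \<and> sorted_wrt (<) j \<and> set j \<subseteq> B}"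
      using finite_subset[OF _ assms] by auto
  qed
  from bij_betw_same_card[OF this] show ?thesis using n_subsets[OF assms, of d] by simp
qed

definition occurring :: "(nat \<Rightarrow> 'a set) \<Rightarrow> nat \<Rightarrow> 'a \<Rightarrow> nat set" where
  "occurring A n \<omega> = {k \<in> {1..n}. \<omega> \<in> A k}"

lemma finite_occurring: "finite (occurring A n \<omega>)"
  by (simp add: occurring_def)

lemma card_occurring_le: "card (occurring A n \<omega>) \<le> n"
proof -
  have "occurring A n \<omega> \<subseteq> {1..n}" by (auto simp: occurring_def)
  from card_mono[OF finite_atLeastAtMost this] show ?thesis by simp
qed

lemma mem_exactly_occur: "\<omega> \<in> space M \<Longrightarrow> \<omega> \<in> exactly_occur M A n i \<longleftrightarrow> card (occurring A n \<omega>) = i"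
  by (simp add: exactly_occur_def occurring_def)

lemma mem_at_least_occur: "\<omega> \<in> space M \<Longrightarrow> \<omega> \<in> at_least_occur M A n r \<longleftrightarrow> r \<le> card (occurring A n \<omega>)"
  using card_occurring_le[of A n \<omega>] by (auto simp: at_least_occur_def mem_exactly_occur)

lemma mem_joint:
  "\<omega> \<in> space M \<Longrightarrow> set j \<subseteq> {1..n} \<Longrightarrow> \<omega> \<in> joint M A j \<longleftrightarrow> set j \<subseteq> occurring A n \<omega>"
  by (auto simp: joint_def occurring_def)

lemma index_tuplesD:
  assumes "j \<in> index_tuples n d"
  shows "length j = d" "distinct j" "set j \<subseteq> {1..n}" "card (set j) = d"
  using assms by (auto simp: index_tuples_def strict_sorted_iff distinct_card)

lemma sum_indicator_exactly_joint:
  assumes "\<omega> \<in> space M" and "j \<in> index_tuples n d"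
  shows "(\<Sum>t\<le>n - d. c t * indicator (exactly_occur M A n (t + d) \<inter> joint M A j) \<omega>)
    = (if \<omega> \<in> joint M A j then c (card (occurring A n \<omega>) - d) else (0 :: real))"
proof (cases "\<omega> \<in> joint M A j")
  case True
  define K where "K = card (occurring A n \<omega>)"
  have "set j \<subseteq> occurring A n \<omega>" using True mem_joint[OF assms(1) index_tuplesD(3)[OF assms(2)]] by simp
  \<comment> \<open>This makes the natural subtraction \<open>K - d\<close> genuine, so exactly the
    summand \<open>t = K - d\<close> survives.\<close>
  then have "d \<le> K"
    unfolding K_def using index_tuplesD(4)[OF assms(2)] card_mono[OF finite_occurring] by metis
  moreover have "K \<le> n" unfolding K_def by (rule card_occurring_le)
  ultimately have "(\<Sum>t\<le>n - d. if t = K - d then c t else 0) = c (K - d)" by simp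
  moreover have "c t * indicator (exactly_occur M A n (t + d) \<inter> joint M A j) \<omega>
      = (if t = K - d then c t else 0)" for t
    using True assms(1) \<open>d \<le> K\<close> by (auto simp: indicator_def mem_exactly_occur K_def[symmetric])
  ultimately show ?thesis using True by (simp add: K_def)
qed simp

text \<open>With \<open>K\<close> occurring events the outcome lies in the intersections of exactly
  \<open>K choose d\<close> tuples, each contributing the same value. For \<open>K < d\<close> this
  count is zero, so the truncated subtraction does no harm.\<close>

lemma sum_indicator_index_tuples:
  assumes "\<omega> \<in> space M"
  shows "(\<Sum>j\<in>index_tuples n d. \<Sum>t\<le>n - d.
      c t * indicator (exactly_occur M A n (t + d) \<inter> joint M A j) \<omega>)
    = c (card (occurring A n \<omega>) - d) * real (card (occurring A n \<omega>) choose d)"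
proof -
  have "{j \<in> index_tuples n d. \<omega> \<in> joint M A j}
      = {j. length j = d \<and> sorted_wrt (<) j \<and> set j \<subseteq> occurring A n \<omega>}"
    using assms by (auto simp: index_tuples_def joint_def occurring_def)
  then have "card {j \<in> index_tuples n d. \<omega> \<in> joint M A j} = card (occurring A n \<omega>) choose d"
    by (simp add: card_sorted_lists_subset finite_occurring)
  moreover have "(\<Sum>j\<in>index_tuples n d. \<Sum>t\<le>n - d.
      c t * indicator (exactly_occur M A n (t + d) \<inter> joint M A j) \<omega>)
    = (\<Sum>j\<in>index_tuples n d. if \<omega> \<in> joint M A j then c (card (occurring A n \<omega>) - d) else 0)"
    by (intro sum.cong refl sum_indicator_exactly_joint assms)
  ultimately show ?thesis
    by (simp add: sum.If_cases finite_index_tuples Int_def)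
qed

text \<open>The reciprocal binomial in the weight cancels the number of tuples. Pairs serve as a
  single index set, as required for transfer to measures and conditional probabilities.\<close>

lemma indicator_at_least_occur:
  assumes "\<omega> \<in> space M" "d \<le> r"
  shows "indicator (at_least_occur M A n r) \<omega> = (\<Sum>x\<in>index_tuples n d \<times> {..n - d}.
    (if r \<le> snd x + d then weight d (snd x) else 0) *
      indicator (exactly_occur M A n (snd x + d) \<inter> joint M A (fst x)) \<omega>)"
  unfolding sum_indicator_index_tuples[OF assms(1), where c = "\<lambda>t. if r \<le> t + d then weight d t else 0",
      unfolded sum.cartesian_product case_prod_unfold]
  using assms by (auto simp: indicator_def mem_at_least_occur weight_def)

lemma indicator_exactly_occur:
  assumes "\<omega> \<in> space M" "d \<le> r"
  shows "indicator (exactly_occur M A n r) \<omega> = (\<Sum>x\<in>index_tuples n d \<times> {..n - d}.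
    (if snd x + d = r then weight d (snd x) else 0) *
      indicator (exactly_occur M A n (snd x + d) \<inter> joint M A (fst x)) \<omega>)"
  unfolding sum_indicator_index_tuples[OF assms(1), where c = "\<lambda>t. if t + d = r then weight d t else 0",
      unfolded sum.cartesian_product case_prod_unfold]
  using assms by (auto simp: indicator_def mem_exactly_occur weight_def)

section \<open>Ordered tuples of further events\<close>

text \<open>The falling factorial; truncated subtraction makes it \<open>0\<close> for
  \<open>k > t\<close>, in agreement with the absence of distinct lists longer than the set.\<close>

definition falling :: "nat \<Rightarrow> nat \<Rightarrow> nat" where
  "falling t k = (\<Prod>i<k. t - i)"

lemma card_distinct_lists:
  assumes "finite B"
  shows "card {u. length u = k \<and> distinct u \<and> set u \<subseteq> B} = falling (card B) k"
proof (cases "k \<le> card B")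
  case True
  have "\<Prod>{card B - k + 1 .. card B} = falling (card B) k"
    unfolding falling_def
    by (rule prod.reindex_bij_witness[where i = "\<lambda>i. card B - i" and j = "\<lambda>i. card B - i"])
      (use True in auto)
  then show ?thesis using card_lists_distinct_length_eq[OF assms True] by simp
next
  case False
  have "{u. length u = k \<and> distinct u \<and> set u \<subseteq> B} = {}"
  proof safe
    fix u assume u: "k = length u" "distinct u" "set u \<subseteq> B"
    then have "length u \<le> card B" using card_mono[OF assms u(3)] distinct_card[OF u(2)] by simp
    then show "u \<in> {}" using False u by simp
  qed
  moreover have "falling (card B) k = 0"
    unfolding falling_def using False by (intro prod_zero bexI[of _ "card B"]) auto
  ultimately show ?thesis by (simp only: card.empty)
qed

text \<open>If \<open>j\<close> occurs together with \<open>t\<close> further events, then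
  \<open>u @ j\<close> occurs exactly when \<open>u\<close> is drawn from those \<open>t\<close>,
  which leaves \<open>falling t k\<close> lists.\<close>

lemma sum_indicator_joint_append:
  assumes "\<omega> \<in> space M" and j: "j \<in> index_tuples n d"
  shows "(\<Sum>u\<in>{u. length u = k \<and> distinct u \<and> set u \<subseteq> {1..n} - set j}. indicator (joint M A (u @ j)) \<omega>)
    = (\<Sum>t\<le>n - d. real (falling t k) * indicator (exactly_occur M A n (t + d) \<inter> joint M A j) \<omega>)"
proof -
  define B where "B = occurring A n \<omega> - set j"
  define U where "U = {u. length u = k \<and> distinct u \<and> set u \<subseteq> {1..n} - set j}"
  have "finite U"
    unfolding U_def by (rule finite_subset[OF _ finite_lists_length_eq[of "{1..n}" k]]) auto
  have "indicator (joint M A (u @ j)) \<omega>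
      = (if \<omega> \<in> joint M A j \<and> set u \<subseteq> B then 1 else (0 :: real))" if "u \<in> U" for u
    using that assms(1) index_tuplesD(3)[OF j]
    by (auto simp: indicator_def U_def joint_def B_def occurring_def)
  then have "(\<Sum>u\<in>U. indicator (joint M A (u @ j)) \<omega>)
      = (\<Sum>u\<in>U. if \<omega> \<in> joint M A j \<and> set u \<subseteq> B then 1 else (0 :: real))" by simp
  also have "\<dots> = (if \<omega> \<in> joint M A j then real (falling (card (occurring A n \<omega>) - d) k) else 0)"
  proof (cases "\<omega> \<in> joint M A j")
    case True
    have "{u \<in> U. set u \<subseteq> B} = {u. length u = k \<and> distinct u \<and> set u \<subseteq> B}"
      by (auto simp: U_def B_def occurring_def)
    moreover have "set j \<subseteq> occurring A n \<omega>" using True mem_joint[OF assms(1) index_tuplesD(3)[OF j]] by simp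
    then have "card B = card (occurring A n \<omega>) - d"
      unfolding B_def using index_tuplesD(4)[OF j] by (simp add: card_Diff_subset)
    ultimately have "card {u \<in> U. set u \<subseteq> B} = falling (card (occurring A n \<omega>) - d) k"
      by (simp add: card_distinct_lists B_def finite_occurring)
    then show ?thesis using True \<open>finite U\<close> by (simp add: sum.If_cases Int_def)
  qed simp
  finally show ?thesis unfolding U_def sum_indicator_exactly_joint[OF assms] .
qed

section \<open>From indicator identities to (conditional) probabilities\<close>

lemma sets_exactly_occur:
  assumes A: "\<And>i. i \<in> {1..n} \<Longrightarrow> A i \<in> sets M"
  shows "exactly_occur M A n i \<in> sets M"
proof -
  have "(\<Sum>k\<in>{1..n}. indicator (A k) \<omega>) = real (card {k \<in> {1..n}. \<omega> \<in> A k})" for \<omega>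
    by (simp add: indicator_def sum.If_cases Int_def)
  then have eq: "exactly_occur M A n i = {\<omega> \<in> space M. (\<Sum>k\<in>{1..n}. indicator (A k) \<omega>) = real i}"
    unfolding exactly_occur_def by simp
  have "(\<lambda>\<omega>. \<Sum>k\<in>{1..n}. indicator (A k) \<omega> :: real) \<in> borel_measurable M"
    using A by (intro borel_measurable_sum borel_measurable_indicator) auto
  then show ?thesis unfolding eq by measurable
qed

lemma sets_at_least_occur:
  assumes "\<And>i. i \<in> {1..n} \<Longrightarrow> A i \<in> sets M"
  shows "at_least_occur M A n r \<in> sets M"
  unfolding at_least_occur_def by (intro sets.finite_UN sets_exactly_occur assms) auto

lemma sets_joint:
  assumes "\<And>i. i \<in> {1..n} \<Longrightarrow> A i \<in> sets M" and "set j \<subseteq> {1..n}"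
  shows "joint M A j \<in> sets M"
proof -
  have "{\<omega> \<in> space M. \<omega> \<in> A k} \<in> sets M" if "k \<in> set j" for k
    using assms sets.Int[of "space M" M "A k"] that by (auto simp: Int_def)
  then show ?thesis unfolding joint_def by (intro sets.sets_Collect_finite_All) auto
qed

lemma (in finite_measure) integral_sum_indicators:
  assumes "\<And>i. i \<in> I \<Longrightarrow> E i \<in> sets M"
  shows "(\<integral>\<omega>. (\<Sum>i\<in>I. c i * indicator (E i) \<omega>) \<partial>M) = (\<Sum>i\<in>I. c i * measure M (E i))"
proof -
  have "(\<integral>\<omega>. (\<Sum>i\<in>I. c i * indicator (E i) \<omega>) \<partial>M) = (\<Sum>i\<in>I. \<integral>\<omega>. c i * indicator (E i) \<omega> \<partial>M)"
    using assms by (intro Bochner_Integration.integral_sum) (auto simp: integrable_indicator_iff emeasure_eq_measure)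
  also have "\<dots> = (\<Sum>i\<in>I. c i * measure M (E i))"
    using assms by (intro sum.cong) auto
  finally show ?thesis .
qed

lemma (in finite_measure) measure_eq_sum_indicators:
  assumes "F \<in> sets M" and "\<And>i. i \<in> I \<Longrightarrow> E i \<in> sets M"
    and "\<And>\<omega>. \<omega> \<in> space M \<Longrightarrow> indicator F \<omega> = (\<Sum>i\<in>I. c i * indicator (E i) \<omega>)"
  shows "measure M F = (\<Sum>i\<in>I. c i * measure M (E i))"
proof -
  have "measure M F = (\<integral>\<omega>. indicator F \<omega> \<partial>M)" using assms(1) by simp
  also have "\<dots> = (\<integral>\<omega>. (\<Sum>i\<in>I. c i * indicator (E i) \<omega>) \<partial>M)"
    by (intro Bochner_Integration.integral_cong assms refl)
  finally show ?thesis using integral_sum_indicators[OF assms(2)] by simp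
qed

lemma (in finite_measure_subalgebra) cond_pr_sum_indicators:
  assumes "\<And>i. i \<in> I \<Longrightarrow> E i \<in> sets M"
  shows "AE \<omega> in M. real_cond_exp M F (\<lambda>\<omega>. \<Sum>i\<in>I. c i * indicator (E i) \<omega>) \<omega>
    = (\<Sum>i\<in>I. c i * cond_pr M F (E i) \<omega>)"
proof (cases "finite I")
  case True
  \<comment> \<open>Extending the family by the empty set makes the indicator integrable at every
    index, not only at those in \<open>I\<close>.\<close>
  define E' where "E' i = (if i \<in> I then E i else {})" for i
  have int: "integrable M (indicator (E' i) :: 'a \<Rightarrow> real)" for i
    using assms by (simp add: E'_def integrable_indicator_iff emeasure_eq_measure)
  have "AE \<omega> in M. real_cond_exp M F (\<lambda>\<omega>. \<Sum>i\<in>I. c i * indicator (E' i) \<omega>) \<omega>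
      = (\<Sum>i\<in>I. real_cond_exp M F (\<lambda>\<omega>. c i * indicator (E' i) \<omega>) \<omega>)"
    by (intro real_cond_exp_sum integrable_mult_right int)
  moreover have "AE \<omega> in M. \<forall>i\<in>I. real_cond_exp M F (\<lambda>\<omega>. c i * indicator (E' i) \<omega>) \<omega>
      = c i * real_cond_exp M F (indicator (E' i)) \<omega>"
    using True by (intro AE_finite_allI real_cond_exp_cmult int)
  ultimately show ?thesis by eventually_elim (simp add: E'_def cond_pr_def cong: sum.cong)
next
  case False
  \<comment> \<open>For infinite \<open>I\<close> both sums are \<open>0\<close> by
    convention.\<close>
  have "AE \<omega> in M. real_cond_exp M F (\<lambda>_. 0) \<omega> = 0"
    by (rule real_cond_exp_F_meas) auto
  then show ?thesis using False by simp
qed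

text \<open>Carries counting identities over to conditional probabilities: equal functions have
  almost surely equal conditional expectations, and these are linear.\<close>

lemma (in finite_measure_subalgebra) cond_pr_eq_sum_indicators:
  assumes I: "\<And>i. i \<in> I \<Longrightarrow> E i \<in> sets M" and J: "\<And>j. j \<in> J \<Longrightarrow> E' j \<in> sets M"
    and eq: "\<And>\<omega>. \<omega> \<in> space M \<Longrightarrow>
      (\<Sum>i\<in>I. c i * indicator (E i) \<omega>) = (\<Sum>j\<in>J. c' j * indicator (E' j) \<omega>)"
  shows "AE \<omega> in M. (\<Sum>i\<in>I. c i * cond_pr M F (E i) \<omega>) = (\<Sum>j\<in>J. c' j * cond_pr M F (E' j) \<omega>)"
proof -
  have "AE \<omega> in M. real_cond_exp M F (\<lambda>\<omega>. \<Sum>i\<in>I. c i * indicator (E i) \<omega>) \<omega>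
      = real_cond_exp M F (\<lambda>\<omega>. \<Sum>j\<in>J. c' j * indicator (E' j) \<omega>) \<omega>"
    using I J eq
    by (intro real_cond_exp_cong AE_I2 borel_measurable_sum borel_measurable_times borel_measurable_indicator
        borel_measurable_const) auto
  moreover have "AE \<omega> in M. real_cond_exp M F (\<lambda>\<omega>. \<Sum>i\<in>I. c i * indicator (E i) \<omega>) \<omega>
      = (\<Sum>i\<in>I. c i * cond_pr M F (E i) \<omega>)"
    by (rule cond_pr_sum_indicators) (rule I)
  moreover have "AE \<omega> in M. real_cond_exp M F (\<lambda>\<omega>. \<Sum>j\<in>J. c' j * indicator (E' j) \<omega>) \<omega>
      = (\<Sum>j\<in>J. c' j * cond_pr M F (E' j) \<omega>)"
    by (rule cond_pr_sum_indicators) (rule J)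
  ultimately show ?thesis by eventually_elim simp
qed

section \<open>The vectors \<open>s\<close> as combinations of moment vectors\<close>

lemma vec3_eqI: "x$1 = y$1 \<Longrightarrow> x$2 = y$2 \<Longrightarrow> x$3 = y$3 \<Longrightarrow> x = (y :: 'b^3)"
  by (simp add: vec_eq_iff forall_3)

lemma falling_moments:
  "fact d / fact (0 + d) * real (falling t 0) = moment_vec d t $ 1"
  "fact d / fact (1 + d) * real (falling t 1) = moment_vec d t $ 2"
  "fact d / fact (2 + d) * real (falling t 2) = moment_vec d t $ 3"
proof -
  have "real (falling t 2) = real t * (real t - 1)"
    by (cases t) (auto simp: falling_def numeral_2_eq_2 lessThan_Suc algebra_simps)
  moreover have "fact (2 + d) = (real d + 1) * (real d + 2) * fact d"
    by (simp add: numeral_2_eq_2 algebra_simps)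
  ultimately show "fact d / fact (2 + d) * real (falling t 2) = moment_vec d t $ 3"
    by (simp add: moment_vec_nth)
qed (simp_all add: moment_vec_nth falling_def lessThan_Suc)

text \<open>Binomial counterpart of \<open>falling_moments\<close>: the definition of
  \<open>s\<close> by \<open>z\<close> and the one by ordered tuples weigh the masses by the same
  moment vectors.\<close>

lemma binomial_ratio_moments:
  "real ((t + d) choose d) / real ((t + d) choose d) = moment_vec d t $ 1"
  "real ((t + d) choose (d + 1)) / real ((t + d) choose d) = moment_vec d t $ 2"
  "real ((t + d) choose (d + 2)) / real ((t + d) choose d) = moment_vec d t $ 3"
proof -
  have p: "real ((t + d) choose d) \<noteq> 0" by simp
  have 1: "real ((t + d) choose (d + 1)) = real ((t + d) choose d) * real t / (real d + 1)"
    using choose_Suc_ratio[of d 0 "t + d"] by simp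
  \<comment> \<open>The ratio formula does not reach \<open>t = 0\<close>; there both binomials
    vanish.\<close>
  have 2: "real ((t + d) choose (d + 2)) = real ((t + d) choose (d + 1)) * (real t - 1) / (real d + 2)"
    using choose_Suc_ratio[of d 1 "t + d"] by (cases t) (simp_all add: add.commute binomial_eq_0)
  show "real ((t + d) choose d) / real ((t + d) choose d) = moment_vec d t $ 1"
    using p by (simp add: moment_vec_nth)
  show "real ((t + d) choose (d + 1)) / real ((t + d) choose d) = moment_vec d t $ 2"
    unfolding 1 using p by (simp add: moment_vec_nth)
  show "real ((t + d) choose (d + 2)) / real ((t + d) choose d) = moment_vec d t $ 3"
    unfolding 2 1 using p by (simp add: moment_vec_nth)
qed

lemma s_coord_eq:
  assumes "1 \<le> k"
  shows "s_coord M A n d j k = (\<Sum>t\<le>n - d. measure M (exactly_occur M A n (t + d) \<inter> joint M A j) *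
    (real ((t + d) choose (k - 1 + d)) / real ((t + d) choose d)))"
  unfolding s_coord_def z_coord_def
  by (rule sum.reindex_bij_witness[where i = Suc and j = "\<lambda>i. i - 1"]) (use assms in auto)

lemma s_vec_eq:
  "s_vec M A n d j = (\<Sum>t\<le>n - d. measure M (exactly_occur M A n (t + d) \<inter> joint M A j) *\<^sub>R moment_vec d t)"
  by (rule vec3_eqI)
    (simp_all add: s_vec_def s_coord_eq binomial_ratio_moments[symmetric] add.commute[of _ d])

lemma weighted_moments_measure:
  assumes "prob_space M" and A: "\<And>i. i \<in> {1..n} \<Longrightarrow> A i \<in> sets M"
  shows "weighted_moments n d (\<lambda>j t. measure M (exactly_occur M A n (t + d) \<inter> joint M A j))
    (s_vec M A n d) (\<lambda>r. measure M (at_least_occur M A n r)) (\<lambda>r. measure M (exactly_occur M A n r))"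
proof -
  interpret prob_space M by fact
  have E: "exactly_occur M A n (snd x + d) \<inter> joint M A (fst x) \<in> sets M"
    if "x \<in> index_tuples n d \<times> {..n - d}" for x
    using that by (auto intro!: sets.Int sets_exactly_occur sets_joint A dest!: index_tuplesD(3))
  show ?thesis
  proof
    fix r assume r: "d \<le> r" "r \<le> n"
    show "measure M (at_least_occur M A n r) = (\<Sum>j\<in>index_tuples n d. \<Sum>t\<le>n - d.
        (if r \<le> t + d then weight d t else 0) * measure M (exactly_occur M A n (t + d) \<inter> joint M A j))"
      unfolding sum.cartesian_product case_prod_unfold
      by (intro measure_eq_sum_indicators sets_at_least_occur A E indicator_at_least_occur r)
    show "measure M (exactly_occur M A n r) = (\<Sum>j\<in>index_tuples n d. \<Sum>t\<le>n - d.
        (if t + d = r then weight d t else 0) * measure M (exactly_occur M A n (t + d) \<inter> joint M A j))"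
      unfolding sum.cartesian_product case_prod_unfold
      by (intro measure_eq_sum_indicators sets_exactly_occur A E indicator_exactly_occur r)
  qed (simp_all add: s_vec_eq)
qed

lemma (in finite_measure_subalgebra) AE_s_cond_coord_eq:
  assumes A: "\<And>i. i \<in> {1..n} \<Longrightarrow> A i \<in> sets M" and j: "j \<in> index_tuples n d" and "1 \<le> k"
  shows "AE \<omega> in M. s_cond_coord M F A n d j k \<omega> = (\<Sum>t\<le>n - d.
    cond_pr M F (exactly_occur M A n (t + d) \<inter> joint M A j) \<omega> * (fact d / fact (k - 1 + d) * real (falling t (k - 1))))"
proof -
  have "AE \<omega> in M. (\<Sum>u\<in>{u. length u = k - 1 \<and> distinct u \<and> set u \<subseteq> {1..n} - set j}.
      1 * cond_pr M F (joint M A (u @ j)) \<omega>)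
    = (\<Sum>t\<le>n - d. real (falling t (k - 1)) * cond_pr M F (exactly_occur M A n (t + d) \<inter> joint M A j) \<omega>)"
  proof (rule cond_pr_eq_sum_indicators)
    fix \<omega> assume "\<omega> \<in> space M"
    from sum_indicator_joint_append[OF this j, where k = "k - 1" and A = A]
    show "(\<Sum>u\<in>{u. length u = k - 1 \<and> distinct u \<and> set u \<subseteq> {1..n} - set j}.
        1 * indicator (joint M A (u @ j)) \<omega>) = (\<Sum>t\<le>n - d. real (falling t (k - 1)) *
          indicator (exactly_occur M A n (t + d) \<inter> joint M A j) \<omega>)" by simp
  next
    fix u assume "u \<in> {u. length u = k - 1 \<and> distinct u \<and> set u \<subseteq> {1..n} - set j}"
    then have "set (u @ j) \<subseteq> {1..n}" using index_tuplesD(3)[OF j] by auto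
    with A show "joint M A (u @ j) \<in> sets M" by (rule sets_joint)
  next
    fix t
    show "exactly_occur M A n (t + d) \<inter> joint M A j \<in> sets M"
      by (intro sets.Int sets_exactly_occur sets_joint[OF _ index_tuplesD(3)[OF j]] A)
  qed
  then show ?thesis
  proof eventually_elim
    case (elim \<omega>)
    moreover have "k + d - 1 = k - 1 + d" using assms(3) by simp
    ultimately show ?case by (simp add: s_cond_coord_def sum_distrib_left mult_ac)
  qed
qed

lemma (in finite_measure_subalgebra) AE_s_cond_vec_eq:
  assumes "\<And>i. i \<in> {1..n} \<Longrightarrow> A i \<in> sets M" and "j \<in> index_tuples n d"
  shows "AE \<omega> in M. s_cond_vec M F A n d j \<omega> = (\<Sum>t\<le>n - d.
    cond_pr M F (exactly_occur M A n (t + d) \<inter> joint M A j) \<omega> *\<^sub>R moment_vec d t)"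
proof -
  have "AE \<omega> in M. \<forall>k\<in>{1, 2, 3}. s_cond_coord M F A n d j k \<omega> = (\<Sum>t\<le>n - d.
      cond_pr M F (exactly_occur M A n (t + d) \<inter> joint M A j) \<omega> *
        (fact d / fact (k - 1 + d) * real (falling t (k - 1))))"
    using assms by (intro AE_finite_allI AE_s_cond_coord_eq) auto
  then show ?thesis
  proof eventually_elim
    case (elim \<omega>)
    then have coord: "s_cond_coord M F A n d j k \<omega> = (\<Sum>t\<le>n - d.
        cond_pr M F (exactly_occur M A n (t + d) \<inter> joint M A j) \<omega> *
          (fact d / fact (k - 1 + d) * real (falling t (k - 1))))" if "k \<in> {1, 2, 3}" for k
      using that by blast
    show ?case
      using coord[of 1] coord[of 2] coord[of 3]
      by (intro vec3_eqI) (simp_all add: s_cond_vec_def falling_moments[symmetric])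
  qed
qed

text \<open>The locale assumptions range over finitely many \<open>j\<close>, \<open>t\<close> and
  \<open>r\<close>, so the almost sure statements hold simultaneously off one null set.\<close>

lemma (in finite_measure_subalgebra) AE_weighted_moments_cond_pr:
  assumes A: "\<And>i. i \<in> {1..n} \<Longrightarrow> A i \<in> sets M"
  shows "AE \<omega> in M. weighted_moments n d (\<lambda>j t. cond_pr M F (exactly_occur M A n (t + d) \<inter> joint M A j) \<omega>)
    (\<lambda>j. s_cond_vec M F A n d j \<omega>) (\<lambda>r. cond_pr M F (at_least_occur M A n r) \<omega>)
    (\<lambda>r. cond_pr M F (exactly_occur M A n r) \<omega>)"
proof -
  have E: "exactly_occur M A n (snd x + d) \<inter> joint M A (fst x) \<in> sets M"
    if "x \<in> index_tuples n d \<times> {..n - d}" for x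
    using that by (auto intro!: sets.Int sets_exactly_occur sets_joint A dest!: index_tuplesD(3))
  have nonneg: "AE \<omega> in M. \<forall>x\<in>index_tuples n d \<times> {..n - d}.
      0 \<le> cond_pr M F (exactly_occur M A n (snd x + d) \<inter> joint M A (fst x)) \<omega>"
    unfolding cond_pr_def using E
    by (intro AE_finite_allI real_cond_exp_pos) (auto simp: finite_index_tuples)
  have s: "AE \<omega> in M. \<forall>j\<in>index_tuples n d. s_cond_vec M F A n d j \<omega> = (\<Sum>t\<le>n - d.
      cond_pr M F (exactly_occur M A n (t + d) \<inter> joint M A j) \<omega> *\<^sub>R moment_vec d t)"
    using A by (intro AE_finite_allI finite_index_tuples AE_s_cond_vec_eq)
  \<comment> \<open>The singleton sum puts a single conditional probability into the form of the
    two-sided transfer lemma.\<close>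
  have "AE \<omega> in M. (\<Sum>i\<in>{()}. 1 * cond_pr M F (at_least_occur M A n r) \<omega>) =
      (\<Sum>x\<in>index_tuples n d \<times> {..n - d}. (if r \<le> snd x + d then weight d (snd x) else 0) *
         cond_pr M F (exactly_occur M A n (snd x + d) \<inter> joint M A (fst x)) \<omega>)"
    if "r \<in> {d..n}" for r
  proof (rule cond_pr_eq_sum_indicators)
    fix \<omega> assume "\<omega> \<in> space M"
    then show "(\<Sum>i\<in>{()}. 1 * indicator (at_least_occur M A n r) \<omega>) =
      (\<Sum>x\<in>index_tuples n d \<times> {..n - d}. (if r \<le> snd x + d then weight d (snd x) else 0) *
         indicator (exactly_occur M A n (snd x + d) \<inter> joint M A (fst x)) \<omega>)"
      using that by (subst indicator_at_least_occur[symmetric]) auto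
  qed (auto intro: sets_at_least_occur A E)
  then have at_least: "AE \<omega> in M. \<forall>r\<in>{d..n}. cond_pr M F (at_least_occur M A n r) \<omega> =
      (\<Sum>j\<in>index_tuples n d. \<Sum>t\<le>n - d. (if r \<le> t + d then weight d t else 0) *
         cond_pr M F (exactly_occur M A n (t + d) \<inter> joint M A j) \<omega>)"
    by (intro AE_finite_allI) (simp_all add: sum.cartesian_product case_prod_unfold)
  have "AE \<omega> in M. (\<Sum>i\<in>{()}. 1 * cond_pr M F (exactly_occur M A n r) \<omega>) =
      (\<Sum>x\<in>index_tuples n d \<times> {..n - d}. (if snd x + d = r then weight d (snd x) else 0) *
         cond_pr M F (exactly_occur M A n (snd x + d) \<inter> joint M A (fst x)) \<omega>)"
    if "r \<in> {d..n}" for r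
  proof (rule cond_pr_eq_sum_indicators)
    fix \<omega> assume "\<omega> \<in> space M"
    then show "(\<Sum>i\<in>{()}. 1 * indicator (exactly_occur M A n r) \<omega>) =
      (\<Sum>x\<in>index_tuples n d \<times> {..n - d}. (if snd x + d = r then weight d (snd x) else 0) *
         indicator (exactly_occur M A n (snd x + d) \<inter> joint M A (fst x)) \<omega>)"
      using that by (subst indicator_exactly_occur[symmetric]) auto
  qed (auto intro: sets_exactly_occur A E)
  then have exactly: "AE \<omega> in M. \<forall>r\<in>{d..n}. cond_pr M F (exactly_occur M A n r) \<omega> =
      (\<Sum>j\<in>index_tuples n d. \<Sum>t\<le>n - d. (if t + d = r then weight d t else 0) *
         cond_pr M F (exactly_occur M A n (t + d) \<inter> joint M A j) \<omega>)"
    by (intro AE_finite_allI) (simp_all add: sum.cartesian_product case_prod_unfold)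
  from nonneg s at_least exactly show ?thesis
    by eventually_elim (unfold_locales, auto)
qed

lemma borel_measurable_inner_s_cond_vec:
  "(\<lambda>\<omega>. v \<bullet> s_cond_vec M G A n d j \<omega>) \<in> borel_measurable G"
  unfolding s_cond_vec_def inner_vec_def sum_3 vector_3 s_cond_coord_def cond_pr_def inner_real_def
  by measurable

section \<open>The bounds\<close>

text \<open>In the combined bounds \<open>gamma_vec\<close> is compared with the probability of at
  least \<open>d\<close> events: for \<open>m = 1\<close> its polynomial is \<open>1\<close> at
  \<open>t = 0\<close>, where the weight truncated at \<open>r > d\<close> is \<open>0\<close>. In
  the conditional bounds the parameters are quantified inside the almost sure statement, so they may
  vary with the outcome.\<close>

theorem theorem4:
  fixes M :: "'a measure" and A :: "nat \<Rightarrow> 'a set" and n r d :: nat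
  assumes "prob_space M"
    and "\<And>i. i \<in> {1..n} \<Longrightarrow> A i \<in> sets M"
    and "1 \<le> r" and "r \<le> n" and "d \<le> r"
  shows
    "(r - d \<ge> 2 \<longrightarrow>
        measure M (at_least_occur M A n r)
          \<ge> (\<Sum>j\<in>index_tuples n d. alpha_vec n r d \<bullet> s_vec M A n d j) \<and>
        measure M (exactly_occur M A n n)
          \<ge> (\<Sum>j\<in>index_tuples n d. delta_vec n d \<bullet> s_vec M A n d j))
     \<and>
     (r - d \<ge> 1 \<and> n - r \<ge> 1 \<longrightarrow>
        (\<forall>m \<in> index_tuples n d \<rightarrow> {r - d + 1..n - d}.
          measure M (at_least_occur M A n r)
            \<ge> (\<Sum>j\<in>index_tuples n d. beta_vec r d (m j) \<bullet> s_vec M A n d j)) \<and>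
        measure M (exactly_occur M A n r)
          \<ge> (\<Sum>j\<in>index_tuples n d. theta_vec r d \<bullet> s_vec M A n d j) \<and>
        (\<forall>j\<in>index_tuples n d.
          if beta_denom r d (s_vec M A n d j) > 0 \<and>
             (\<exists>m\<in>{r - d + 1..n - d}. beta_criterion r d (s_vec M A n d j) m)
          then \<forall>m\<in>{r - d + 1..n - d}.
                 beta_optimal n r d (s_vec M A n d j) m \<longleftrightarrow> beta_criterion r d (s_vec M A n d j) m
          else beta_optimal n r d (s_vec M A n d j) (r - d + 1) \<or>
               beta_optimal n r d (s_vec M A n d j) (n - d)))
     \<and>
     (n - r \<ge> 2 \<and> r = d \<longrightarrow>
        (\<forall>m \<in> index_tuples n d \<rightarrow> {1..n - d - 1}.
          measure M (at_least_occur M A n d)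
            \<ge> (\<Sum>j\<in>index_tuples n d. gamma_vec n d (m j) \<bullet> s_vec M A n d j)) \<and>
        measure M (exactly_occur M A n d)
          \<ge> (\<Sum>j\<in>index_tuples n d. phi_vec n d \<bullet> s_vec M A n d j) \<and>
        (\<forall>j\<in>index_tuples n d.
          if gamma_denom n d (s_vec M A n d j) > 0
          then (\<exists>m\<in>{1..n - d - 1}. gamma_criterion n d (s_vec M A n d j) m) \<and>
               (\<forall>m\<in>{1..n - d - 1}.
                 gamma_optimal n d (s_vec M A n d j) m \<longleftrightarrow> gamma_criterion n d (s_vec M A n d j) m)
          else gamma_optimal n d (s_vec M A n d j) 1 \<or>
               gamma_optimal n d (s_vec M A n d j) (n - d - 1)))
     \<and>
     (r - d \<ge> 2 \<and> n - r \<ge> 1 \<longrightarrow>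
        (\<forall>m \<in> index_tuples n d \<rightarrow> {r - d + 1..n - d}. \<forall>m' \<in> index_tuples n d \<rightarrow> {1..n - d - 1}.
          measure M (at_least_occur M A n r)
            \<ge> (\<Sum>j\<in>index_tuples n d.
                 max (alpha_vec n r d \<bullet> s_vec M A n d j) (beta_vec r d (m j) \<bullet> s_vec M A n d j)) \<and>
          measure M (at_least_occur M A n d)
            \<ge> (\<Sum>j\<in>index_tuples n d.
                 Max {alpha_vec n r d \<bullet> s_vec M A n d j, beta_vec r d (m j) \<bullet> s_vec M A n d j,
                      gamma_vec n d (m' j) \<bullet> s_vec M A n d j})))
     \<and>
     (\<forall>G. subalgebra M G \<longrightarrow>
        (r - d \<ge> 2 \<longrightarrow> (AE \<omega> in M.
          cond_pr M G (at_least_occur M A n r) \<omega>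
            \<ge> (\<Sum>j\<in>index_tuples n d. alpha_vec n r d \<bullet> s_cond_vec M G A n d j \<omega>) \<and>
          cond_pr M G (exactly_occur M A n n) \<omega>
            \<ge> (\<Sum>j\<in>index_tuples n d. delta_vec n d \<bullet> s_cond_vec M G A n d j \<omega>)))
        \<and>
        (r - d \<ge> 1 \<and> n - r \<ge> 1 \<longrightarrow>
          (AE \<omega> in M.
            (\<forall>m \<in> index_tuples n d \<rightarrow> {r - d + 1..n - d}.
              cond_pr M G (at_least_occur M A n r) \<omega>
                \<ge> (\<Sum>j\<in>index_tuples n d. beta_vec r d (m j) \<bullet> s_cond_vec M G A n d j \<omega>)) \<and>
            cond_pr M G (exactly_occur M A n r) \<omega>
              \<ge> (\<Sum>j\<in>index_tuples n d. theta_vec r d \<bullet> s_cond_vec M G A n d j \<omega>) \<and>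
            (\<forall>j\<in>index_tuples n d.
              if beta_denom r d (s_cond_vec M G A n d j \<omega>) > 0 \<and>
                 (\<exists>m\<in>{r - d + 1..n - d}. beta_criterion r d (s_cond_vec M G A n d j \<omega>) m)
              then \<forall>m\<in>{r - d + 1..n - d}.
                     beta_optimal n r d (s_cond_vec M G A n d j \<omega>) m
                       \<longleftrightarrow> beta_criterion r d (s_cond_vec M G A n d j \<omega>) m
              else beta_optimal n r d (s_cond_vec M G A n d j \<omega>) (r - d + 1) \<or>
                   beta_optimal n r d (s_cond_vec M G A n d j \<omega>) (n - d))) \<and>
          (\<exists>m. (\<forall>j\<in>index_tuples n d. m j \<in> measurable G (count_space UNIV)) \<and>
               (AE \<omega> in M. \<forall>j\<in>index_tuples n d.
                  beta_optimal n r d (s_cond_vec M G A n d j \<omega>) (m j \<omega>))))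
        \<and>
        (n - r \<ge> 2 \<and> r = d \<longrightarrow>
          (AE \<omega> in M.
            (\<forall>m \<in> index_tuples n d \<rightarrow> {1..n - d - 1}.
              cond_pr M G (at_least_occur M A n d) \<omega>
                \<ge> (\<Sum>j\<in>index_tuples n d. gamma_vec n d (m j) \<bullet> s_cond_vec M G A n d j \<omega>)) \<and>
            cond_pr M G (exactly_occur M A n d) \<omega>
              \<ge> (\<Sum>j\<in>index_tuples n d. phi_vec n d \<bullet> s_cond_vec M G A n d j \<omega>) \<and>
            (\<forall>j\<in>index_tuples n d.
              if gamma_denom n d (s_cond_vec M G A n d j \<omega>) > 0
              then (\<exists>m\<in>{1..n - d - 1}. gamma_criterion n d (s_cond_vec M G A n d j \<omega>) m) \<and>
                   (\<forall>m\<in>{1..n - d - 1}.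
                     gamma_optimal n d (s_cond_vec M G A n d j \<omega>) m
                       \<longleftrightarrow> gamma_criterion n d (s_cond_vec M G A n d j \<omega>) m)
              else gamma_optimal n d (s_cond_vec M G A n d j \<omega>) 1 \<or>
                   gamma_optimal n d (s_cond_vec M G A n d j \<omega>) (n - d - 1))) \<and>
          (\<exists>m. (\<forall>j\<in>index_tuples n d. m j \<in> measurable G (count_space UNIV)) \<and>
               (AE \<omega> in M. \<forall>j\<in>index_tuples n d.
                  gamma_optimal n d (s_cond_vec M G A n d j \<omega>) (m j \<omega>))))
        \<and>
        (r - d \<ge> 2 \<and> n - r \<ge> 1 \<longrightarrow>
          (AE \<omega> in M.
            \<forall>m \<in> index_tuples n d \<rightarrow> {r - d + 1..n - d}. \<forall>m' \<in> index_tuples n d \<rightarrow> {1..n - d - 1}.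
              cond_pr M G (at_least_occur M A n r) \<omega>
                \<ge> (\<Sum>j\<in>index_tuples n d.
                     max (alpha_vec n r d \<bullet> s_cond_vec M G A n d j \<omega>)
                         (beta_vec r d (m j) \<bullet> s_cond_vec M G A n d j \<omega>)) \<and>
              cond_pr M G (at_least_occur M A n d) \<omega>
                \<ge> (\<Sum>j\<in>index_tuples n d.
                     Max {alpha_vec n r d \<bullet> s_cond_vec M G A n d j \<omega>,
                          beta_vec r d (m j) \<bullet> s_cond_vec M G A n d j \<omega>,
                          gamma_vec n d (m' j) \<bullet> s_cond_vec M G A n d j \<omega>}))))"
proof -
  interpret M: prob_space M by fact
  interpret W: weighted_moments n d "\<lambda>j t. measure M (exactly_occur M A n (t + d) \<inter> joint M A j)"
    "s_vec M A n d" "\<lambda>r. measure M (at_least_occur M A n r)" "\<lambda>r. measure M (exactly_occur M A n r)"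
    by (rule weighted_moments_measure) (use assms in auto)
  have cond: "AE \<omega> in M. weighted_moments n d
      (\<lambda>j t. cond_pr M G (exactly_occur M A n (t + d) \<inter> joint M A j) \<omega>)
      (\<lambda>j. s_cond_vec M G A n d j \<omega>) (\<lambda>r. cond_pr M G (at_least_occur M A n r) \<omega>)
      (\<lambda>r. cond_pr M G (exactly_occur M A n r) \<omega>)" if "subalgebra M G" for G
  proof -
    interpret finite_measure_subalgebra M G by unfold_locales (rule that)
    show ?thesis by (rule AE_weighted_moments_cond_pr) (rule assms)
  qed
  \<comment> \<open>The statement on random parameters: a \<open>G\<close>-measurable maximizer is
    chosen for each tuple separately.\<close>
  have select: "\<exists>m. (\<forall>j\<in>index_tuples n d. m j \<in> measurable G (count_space UNIV)) \<and>
      (AE \<omega> in M. \<forall>j\<in>index_tuples n d.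
        is_arg_max (\<lambda>m. v m \<bullet> s_cond_vec M G A n d j \<omega>) (\<lambda>m. m \<in> {a..b}) (m j \<omega>))"
    if "a \<le> b" for G a b and v :: "nat \<Rightarrow> real^3"
  proof -
    have "\<forall>j. \<exists>f. f \<in> measurable G (count_space UNIV) \<and> (\<forall>\<omega>.
        is_arg_max (\<lambda>m. v m \<bullet> s_cond_vec M G A n d j \<omega>) (\<lambda>m. m \<in> {a..b}) (f \<omega>))"
      by (intro allI ex_measurable_arg_max[unfolded Bex_def] borel_measurable_inner_s_cond_vec that)
    from choice[OF this] obtain m where "\<forall>j. m j \<in> measurable G (count_space UNIV) \<and> (\<forall>\<omega>.
        is_arg_max (\<lambda>m. v m \<bullet> s_cond_vec M G A n d j \<omega>) (\<lambda>m. m \<in> {a..b}) (m j \<omega>))"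
      by (rule exE)
    then show ?thesis by (intro exI[of _ m]) auto
  qed
  have gamma_optimality': "if gamma_denom n d (s j) > 0
      then (\<exists>m\<in>{1..n - d - 1}. gamma_criterion n d (s j) m) \<and>
        (\<forall>m\<in>{1..n - d - 1}. gamma_optimal n d (s j) m \<longleftrightarrow> gamma_criterion n d (s j) m)
      else gamma_optimal n d (s j) 1 \<or> gamma_optimal n d (s j) (n - d - 1)"
    if "weighted_moments n d q s a e" "n - r \<ge> 2 \<and> r = d" "j \<in> index_tuples n d" for q s a e j
    \<comment> \<open>From \<open>r = d\<close> and \<open>1 \<le> r\<close> follows
      \<open>1 \<le> d\<close>, which the strict gain requires.\<close>
    using that assms(3) weighted_moments.gamma_range[OF that(1,3)] by (intro gamma_optimality) auto
  have nr: "r - d \<le> n - d" using assms by simp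
  show ?thesis
  \<comment> \<open>Cases 1 to 10 are the unconditional claims; cases 11 to 16 interpret the locale
    at almost every outcome or select the random parameters.\<close>
  proof (intro conjI impI allI ballI, goal_cases)
    case 1 then show ?case using assms by (intro W.alpha_bound)
  next
    case 2 then show ?case using assms by (intro W.delta_bound) auto
  next
    case (3 m) then show ?case using assms by (intro W.beta_bound)
  next
    case 4 then show ?case using assms by (intro W.theta_bound)
  next
    case (5 j) then show ?case using assms by (intro beta_optimality) auto
  next
    case (6 m) then show ?case using assms by (intro W.gamma_bound) auto
  next
    case 7 then show ?case using assms by (intro W.phi_bound) auto
  next
    case (8 j) then show ?case by (intro gamma_optimality'[OF W.weighted_moments_axioms])
  next
    case (9 m m') then show ?case using assms by (intro W.max_bound) auto
  next
    case (10 m m') then show ?case using assms by (intro W.Max_bound) auto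
  next
    case (11 G)
    from cond[OF 11(1)] show ?case
    proof eventually_elim
      case (elim \<omega>)
      then interpret C: weighted_moments n d
        "\<lambda>j t. cond_pr M G (exactly_occur M A n (t + d) \<inter> joint M A j) \<omega>"
        "\<lambda>j. s_cond_vec M G A n d j \<omega>" "\<lambda>r. cond_pr M G (at_least_occur M A n r) \<omega>"
        "\<lambda>r. cond_pr M G (exactly_occur M A n r) \<omega>" .
      show ?case using 11 assms by (intro conjI C.alpha_bound C.delta_bound) auto
    qed
  next
    case (12 G)
    from cond[OF 12(1)] show ?case
    proof eventually_elim
      case (elim \<omega>)
      then interpret C: weighted_moments n d
        "\<lambda>j t. cond_pr M G (exactly_occur M A n (t + d) \<inter> joint M A j) \<omega>"
        "\<lambda>j. s_cond_vec M G A n d j \<omega>" "\<lambda>r. cond_pr M G (at_least_occur M A n r) \<omega>"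
        "\<lambda>r. cond_pr M G (exactly_occur M A n r) \<omega>" .
      show ?case
        using 12 assms by (intro conjI ballI C.beta_bound C.theta_bound beta_optimality) auto
    qed
  next
    case (13 G)
    then have "r - d + 1 \<le> n - d" using nr assms by linarith
    then show ?case unfolding beta_optimal_def by (rule select)
  next
    case (14 G)
    from cond[OF 14(1)] show ?case
    proof eventually_elim
      case (elim \<omega>)
      then interpret C: weighted_moments n d
        "\<lambda>j t. cond_pr M G (exactly_occur M A n (t + d) \<inter> joint M A j) \<omega>"
        "\<lambda>j. s_cond_vec M G A n d j \<omega>" "\<lambda>r. cond_pr M G (at_least_occur M A n r) \<omega>"
        "\<lambda>r. cond_pr M G (exactly_occur M A n r) \<omega>" .
      show ?case
        using 14 assms
        by (intro conjI ballI C.gamma_bound C.phi_bound gamma_optimality'[OF C.weighted_moments_axioms 14(2)]) auto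
    qed
  next
    case (15 G)
    then have "1 \<le> n - d - 1" by linarith
    then show ?case unfolding gamma_optimal_def by (rule select)
  next
    case (16 G)
    from cond[OF 16(1)] show ?case
    proof eventually_elim
      case (elim \<omega>)
      then interpret C: weighted_moments n d
        "\<lambda>j t. cond_pr M G (exactly_occur M A n (t + d) \<inter> joint M A j) \<omega>"
        "\<lambda>j. s_cond_vec M G A n d j \<omega>" "\<lambda>r. cond_pr M G (at_least_occur M A n r) \<omega>"
        "\<lambda>r. cond_pr M G (exactly_occur M A n r) \<omega>" .
      show ?case using 16 assms by (intro ballI conjI C.max_bound C.Max_bound) auto
    qed
  qed
qed

end
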